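(* For every natural number $k$, \[r(B_n^{(k)}) = 2^k n + o_k(n)\] as $n \to \infty$; that is, for every $k$, $r(B_n^{(k)})/n \to 2^k$ as $n \to \infty$.
   Context: For a graph $H$, the Ramsey number $r(H)$ is the smallest natural number $N$ such that every two-colouring of the edges of the complete graph $K_N$ contains a monochromatic copy of $H$. The book $B_n^{(k)}$ is the graph consisting of $n$ copies of $K_{k+1}$ all sharing a common $K_k$ (so it has $k+n$ vertices: a $k$-clique, and $n$ further vertices each adjacent to all vertices of that $k$-clique and to nothing else). The notation $o_k(n)$ denotes a quantity $f(k,n)$ with $f(k,n)/n \to 0$ as $n \to \infty$ for each fixed $k$. *)

theory Defs
  imports Complex_Main "HOL-Library.Ramsey" "HOL-Library.Landau_Symbols"
begin

text \<open>A simple graph is a pair of a vertex set \<open>V\<close> and an edge set \<open>E \<subseteq> [V]\<^bsup>2\<^esup>\<close>.\<close>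

type_synonym 'a graph = "'a set \<times> 'a set set"

definition complete_graph :: "'a set \<Rightarrow> 'a graph" where
  "complete_graph V = (V, [V]\<^bsup>2\<^esup>)"

text \<open>Copies are not required to be induced. If \<open>H\<close> has no edges, every embedding of its
  vertices counts as monochromatic.\<close>

definition mono_copy :: "'a graph \<Rightarrow> 'b graph \<Rightarrow> ('b set \<Rightarrow> bool) \<Rightarrow> bool" where
  "mono_copy H G \<chi> \<longleftrightarrow>
     (\<exists>f c. inj_on f (fst H) \<and> f ` fst H \<subseteq> fst G \<and>
        (\<forall>e\<in>snd H. f ` e \<in> snd G \<and> \<chi> (f ` e) = c))"

text \<open>A colouring is a total function on vertex sets, of which only the values on edges of
  the complete graph matter.\<close>

definition ramsey_number :: "'a graph \<Rightarrow> nat" where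
  "ramsey_number H = (LEAST N. \<forall>\<chi>. mono_copy H (complete_graph {..<N}) \<chi>)"

text \<open>The spine is \<open>{..<k}\<close> and the pages are \<open>{k..<k + n}\<close>.\<close>

definition book :: "nat \<Rightarrow> nat \<Rightarrow> nat graph" where
  "book k n =
     ({..<k + n}, [{..<k}]\<^bsup>2\<^esup> \<union> {{u, v} | u v. u \<in> {..<k} \<and> v \<in> {k..<k + n}})"

lemma book_simple_graph: "snd (book k n) \<subseteq> [fst (book k n)]\<^bsup>2\<^esup>"
proof -
  have "[{..<k}]\<^bsup>2\<^esup> \<subseteq> [{..<k + n}]\<^bsup>2\<^esup>"
    by (intro nsets_mono) auto
  then show ?thesis
    by (auto simp: book_def)
qed

lemma ramsey_number_exists:
  assumes "finite V" "E \<subseteq> [V]\<^bsup>2\<^esup>"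
  shows "\<exists>N::nat. \<forall>\<chi>. mono_copy (V, E) (complete_graph {..<N}) \<chi>"
proof -
  obtain N :: nat where N: "partn_lst {..<N} [card V, card V] 2"
    using ramsey2_full by blast
  have "mono_copy (V, E) (complete_graph {..<N}) \<chi>" for \<chi>
  proof -
    define g where "g = (\<lambda>e. if \<chi> e then 0 else 1 :: nat)"
    have "g \<in> [{..<N}]\<^bsup>2\<^esup> \<rightarrow> {..<length [card V, card V]}"
      by (auto simp: g_def)
    then obtain i where i: "i < 2" "monochromatic {..<N} ([card V, card V] ! i) 2 g i"
      using N unfolding partn_lst_def by (metis One_nat_def Suc_1 length_Cons list.size(3))
    moreover have "[card V, card V] ! i = card V"
      using i(1) by (auto simp: less_2_cases_iff)
    ultimately obtain W where W: "W \<in> [{..<N}]\<^bsup>(card V)\<^esup>" "g ` [W]\<^bsup>2\<^esup> \<subseteq> {i}"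
      unfolding monochromatic_def by metis
    then obtain f where f: "bij_betw f V W"
      using assms(1) finite_same_card_bij[of V W] by (auto simp: nsets_def)
    have "f ` e \<in> [{..<N}]\<^bsup>2\<^esup> \<and> \<chi> (f ` e) = (i = 0)" if "e \<in> E" for e
    proof -
      have "f ` e \<in> [W]\<^bsup>2\<^esup>"
        using bij_betwE[OF bij_betw_nsets[OF f, of 2]] that assms(2) by blast
      moreover have "[W]\<^bsup>2\<^esup> \<subseteq> [{..<N}]\<^bsup>2\<^esup>"
        using W(1) by (intro nsets_mono) (auto simp: nsets_def)
      ultimately show ?thesis
        using W(2) by (auto simp: g_def image_subset_iff split: if_splits)
    qed
    moreover have "inj_on f V" "f ` V \<subseteq> {..<N}"
      using f W(1) by (auto simp: bij_betw_def nsets_def)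
    ultimately show ?thesis
      unfolding mono_copy_def complete_graph_def fst_conv snd_conv by blast
  qed
  then show ?thesis
    by blast
qed

end

theory Submission
  imports Defs "HOL-Analysis.Convex" "HOL-Library.Disjoint_Sets"
begin

text \<open>
  Lower bound: in a uniformly random colouring the number of pages of a fixed monochromatic
  \<open>k\<close>-clique is binomial with mean about \<open>N / 2\<^sup>k\<close>, and a Chernoff bound beats the union bound over the
  at most \<open>N\<^sup>k\<close> spines.

  Upper bound, without a regularity lemma: fix a colouring of \<open>K\<^sub>N\<close> in which every monochromatic
  \<open>k\<close>-clique has at most \<open>n\<close> pages, and write \<open>d(u, W)\<close> for the proportion of vertices of \<open>W\<close> joined to
  \<open>u\<close> in red. If \<open>W\<close> is a large red clique, double counting gives
  \<open>\<Sum>\<^sub>u d(u, W)\<^sup>k \<le> n + o(N)\<close>, and by convexity this property passes to disjoint unions. With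
  Ramsey's theorem one finds, up to exchanging the colours, a set \<open>R\<close> of at least half of the vertices
  such that every large subset of \<open>R\<close> is almost entirely a set \<open>W\<close> of this kind.

  Choose \<open>j \<le> k\<close> maximal such that \<open>R\<close> contains a positive proportion of blue \<open>j\<close>-cliques. A density
  increment gives \<open>W\<^sub>1, \<dots>, W\<^sub>j \<subseteq> R\<close> such that sub-boxes of \<open>W\<^sub>1 \<times> \<dots> \<times> W\<^sub>j\<close> contain at least
  about their share of the blue cliques. Let \<open>x\<^sub>i(u)\<close> be the blue density of \<open>u\<close> to \<open>W\<^sub>i\<close>, so that
  \<open>\<Sum>\<^sub>u (1 - x\<^sub>i(u))\<^sup>k \<le> n + o(N)\<close>. If \<open>j = k\<close>, then also \<open>\<Sum>\<^sub>u \<Prod>\<^sub>i x\<^sub>i(u) \<le> n + o(N)\<close>, and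
  \<open>\<Prod>\<^sub>i x\<^sub>i + (1/k) \<Sum>\<^sub>i (1 - x\<^sub>i)\<^sup>k \<ge> 2\<^bsup>1-k\<^esup>\<close> finishes. If \<open>j < k\<close>, then \<open>\<Prod>\<^sub>i x\<^sub>i(u)\<close> is small for most
  \<open>u \<in> R\<close>, so \<open>\<Sum>\<^sub>i (1 - x\<^sub>i(u))\<^sup>k\<close> is essentially at least 1 there and
  \<open>N / 2 \<le> (k - 1) n + o(N)\<close>, which suffices since \<open>2 (k - 1) \<le> 2\<^sup>k\<close>.
\<close>

subsection \<open>Counting cliques in boxes\<close>

text \<open>Ordered tuples of pairwise adjacent vertices, the \<open>i\<close>-th one taken from
  \<open>U i\<close>. The vertex of highest index is chosen first and the other sides shrink to its
  neighbourhood, which fixes the shape of all inductions on \<open>k\<close>.\<close>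

primrec clique_count :: "('a \<Rightarrow> 'a \<Rightarrow> bool) \<Rightarrow> nat \<Rightarrow> (nat \<Rightarrow> 'a set) \<Rightarrow> real" where
  "clique_count E 0 U = 1"
| "clique_count E (Suc k) U = (\<Sum>u\<in>U k. clique_count E k (\<lambda>i. U i \<inter> Collect (E u)))"

lemma clique_count_nonneg: "0 \<le> clique_count E k U"
  by (induction k arbitrary: U) (auto intro: sum_nonneg)

lemma clique_count_cong:
  "(\<And>i. i < k \<Longrightarrow> U i = W i) \<Longrightarrow> clique_count E k U = clique_count E k W"
proof (induction k arbitrary: U W)
  case (Suc k)
  have "U k = W k"
    using Suc.prems by simp
  moreover have "clique_count E k (\<lambda>i. U i \<inter> Collect (E u)) = clique_count E k (\<lambda>i. W i \<inter> Collect (E u))" for u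
    by (rule Suc.IH) (use Suc.prems in auto)
  ultimately show ?case
    by simp
qed simp

lemma clique_count_mono:
  "(\<And>i. i < k \<Longrightarrow> U i \<subseteq> W i \<and> finite (W i)) \<Longrightarrow> clique_count E k U \<le> clique_count E k W"
proof (induction k arbitrary: U W)
  case (Suc k)
  have "clique_count E (Suc k) U \<le> (\<Sum>u\<in>U k. clique_count E k (\<lambda>i. W i \<inter> Collect (E u)))"
    unfolding clique_count.simps
    by (intro sum_mono Suc.IH) (use Suc.prems less_SucI in blast)
  also have "\<dots> \<le> clique_count E (Suc k) W"
    unfolding clique_count.simps
    by (intro sum_mono2) (use Suc.prems in \<open>auto simp: clique_count_nonneg\<close>)
  finally show ?case .
qed simp

lemma clique_count_le_prod:
  "(\<And>i. i < k \<Longrightarrow> finite (U i)) \<Longrightarrow> clique_count E k U \<le> (\<Prod>i<k. real (card (U i)))"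
proof (induction k arbitrary: U)
  case (Suc k)
  have "clique_count E k (\<lambda>i. U i \<inter> Collect (E u)) \<le> (\<Prod>i<k. real (card (U i)))" for u
  proof -
    have "clique_count E k (\<lambda>i. U i \<inter> Collect (E u)) \<le> clique_count E k U"
      by (intro clique_count_mono) (use Suc.prems in auto)
    also have "\<dots> \<le> (\<Prod>i<k. real (card (U i)))"
      by (intro Suc.IH) (use Suc.prems in auto)
    finally show ?thesis .
  qed
  then have "clique_count E (Suc k) U \<le> (\<Sum>u\<in>U k. \<Prod>i<k. real (card (U i)))"
    unfolding clique_count.simps by (rule sum_mono)
  then show ?case
    by (simp add: mult.commute)
qed simp

text \<open>If the split side is the one chosen first, its sum splits; otherwise the update commutes
  with passing to neighbourhoods. This additivity allows parts of a box to be peeled off.\<close>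

lemma clique_count_Un:
  assumes "m < k" "finite A" "finite B" "A \<inter> B = {}"
  shows "clique_count E k (U(m := A \<union> B)) = clique_count E k (U(m := A)) + clique_count E k (U(m := B))"
  using assms
proof (induction k arbitrary: U A B)
  case (Suc k)
  show ?case
  proof (cases "m = k")
    case True
    have "clique_count E k (\<lambda>i. (U(k := X)) i \<inter> Collect (E u)) = clique_count E k (\<lambda>i. U i \<inter> Collect (E u))" for X u
      by (rule clique_count_cong) auto
    then show ?thesis
      using Suc.prems True by (simp add: sum.union_disjoint)
  next
    case False
    have "(\<lambda>i. (U(m := X)) i \<inter> Collect (E u)) = (\<lambda>i. U i \<inter> Collect (E u))(m := X \<inter> Collect (E u))" for X u
      by (rule ext) auto
    moreover have "clique_count E k ((\<lambda>i. U i \<inter> Collect (E u))(m := (A \<union> B) \<inter> Collect (E u)))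
      = clique_count E k ((\<lambda>i. U i \<inter> Collect (E u))(m := A \<inter> Collect (E u)))
      + clique_count E k ((\<lambda>i. U i \<inter> Collect (E u))(m := B \<inter> Collect (E u)))" for u
      unfolding Int_Un_distrib2
      by (intro Suc.IH) (use Suc.prems False in auto)
    ultimately show ?thesis
      using False by (simp add: sum.distrib)
  qed
qed simp

text \<open>The induction keeps track of the set \<open>S\<close> of vertices already chosen: the pages are then counted
  in its common neighbourhood.\<close>

lemma sum_clique_count_le:
  assumes sym: "\<And>u v. E u v \<Longrightarrow> E v u" and irr: "\<And>u. \<not> E u u" and "finite V"
    and pages: "\<And>S. S \<subseteq> V \<Longrightarrow> card S = k \<Longrightarrow> (\<And>s t. s \<in> S \<Longrightarrow> t \<in> S \<Longrightarrow> s \<noteq> t \<Longrightarrow> E s t)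
      \<Longrightarrow> card {u \<in> V. \<forall>s\<in>S. E s u} \<le> n"
    and U: "\<And>i. i < k \<Longrightarrow> U i \<subseteq> V"
  shows "(\<Sum>u\<in>V. clique_count E k (\<lambda>i. U i \<inter> Collect (E u))) \<le> real n * clique_count E k U"
proof -
  define CN where "CN S = {u \<in> V. \<forall>s\<in>S. E s u}" for S
  have "(\<Sum>u\<in>CN S. clique_count E l (\<lambda>i. U i \<inter> Collect (E u))) \<le> real n * clique_count E l U"
    if "S \<subseteq> V" "card S + l = k" "\<And>s t. s \<in> S \<Longrightarrow> t \<in> S \<Longrightarrow> s \<noteq> t \<Longrightarrow> E s t"
      "\<And>i. i < l \<Longrightarrow> U i \<subseteq> CN S" for S U l
    using that
  proof (induction l arbitrary: S U)
    case 0
    then show ?case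
      using pages[of S] by (simp add: CN_def)
  next
    case (Suc l)
    have fin: "finite (CN S)" "finite (U l)"
      using \<open>finite V\<close> Suc.prems(4)[of l] by (auto simp: CN_def intro: finite_subset)
    have "finite S"
      using Suc.prems(1) \<open>finite V\<close> finite_subset by blast
    have "(\<Sum>u\<in>CN S. clique_count E (Suc l) (\<lambda>i. U i \<inter> Collect (E u)))
      = (\<Sum>u\<in>CN S. \<Sum>v\<in>{v \<in> U l. E u v}. clique_count E l (\<lambda>i. U i \<inter> Collect (E u) \<inter> Collect (E v)))"
      by (simp add: Int_def)
    \<comment> \<open>Choosing the tuple vertex \<open>v\<close> before the page \<open>u\<close>
      lets \<open>v\<close> join \<open>S\<close>.\<close>
    also have "\<dots> = (\<Sum>v\<in>U l. \<Sum>u\<in>{u \<in> CN S. E u v}. clique_count E l (\<lambda>i. U i \<inter> Collect (E u) \<inter> Collect (E v)))"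
      by (rule sum.swap_restrict) (use fin in auto)
    also have "\<dots> \<le> (\<Sum>v\<in>U l. real n * clique_count E l (\<lambda>i. U i \<inter> Collect (E v)))"
    proof (rule sum_mono)
      fix v assume v: "v \<in> U l"
      then have vS: "v \<in> V" "\<And>s. s \<in> S \<Longrightarrow> E s v"
        using Suc.prems(4)[of l] by (auto simp: CN_def)
      then have "v \<notin> S"
        using irr by blast
      have "{u \<in> CN S. E u v} = CN (insert v S)"
        using sym by (auto simp: CN_def)
      moreover have "(\<Sum>u\<in>CN (insert v S). clique_count E l (\<lambda>i. (U i \<inter> Collect (E v)) \<inter> Collect (E u)))
          \<le> real n * clique_count E l (\<lambda>i. U i \<inter> Collect (E v))"
      proof (rule Suc.IH)
        show "card (insert v S) + l = k"
          using \<open>v \<notin> S\<close> \<open>finite S\<close> Suc.prems(2) by simp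
        show "U i \<inter> Collect (E v) \<subseteq> CN (insert v S)" if "i < l" for i
          using Suc.prems(4)[of i] that by (auto simp: CN_def)
      qed (use vS Suc.prems sym in auto)
      ultimately show "(\<Sum>u\<in>{u \<in> CN S. E u v}. clique_count E l (\<lambda>i. U i \<inter> Collect (E u) \<inter> Collect (E v)))
          \<le> real n * clique_count E l (\<lambda>i. U i \<inter> Collect (E v))"
        by (simp add: Int_ac)
    qed
    finally show ?case
      by (simp add: sum_distrib_left)
  qed
  from this[of "{}" k U] U show ?thesis
    by (simp add: CN_def)
qed

text \<open>An upper bound for all sub-boxes yields a lower bound for each of them, because the complement of
  a sub-box is a disjoint union of \<open>k\<close> boxes.\<close>

lemma clique_count_lower_regular:
  fixes U A :: "nat \<Rightarrow> 'a set"
  assumes U: "\<And>i. i < k \<Longrightarrow> finite (U i) \<and> U i \<noteq> {}"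
    and upper: "\<And>A. (\<And>i. i < k \<Longrightarrow> A i \<subseteq> U i) \<Longrightarrow>
      clique_count E k A \<le> ((\<Prod>i<k. card (A i) / card (U i)) + \<alpha>) * clique_count E k U"
    and A: "\<And>i. i < k \<Longrightarrow> A i \<subseteq> U i"
  shows "((\<Prod>i<k. card (A i) / card (U i)) - k * \<alpha>) * clique_count E k U \<le> clique_count E k A"
proof -
  \<comment> \<open>\<open>H m\<close> interpolates between \<open>U\<close> at \<open>m = 0\<close>
    and \<open>A\<close> at \<open>m = k\<close>. Each step removes one box \<open>D\<close> and
    costs one \<alpha>.\<close>
  define H where "H m = (\<lambda>i. if i < m then A i else U i)" for m :: nat
  define vol where "vol W = (\<Prod>i<k. card (W i) / card (U i))" for W :: "nat \<Rightarrow> 'a set"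
  have "(vol (H m) - m * \<alpha>) * clique_count E k U \<le> clique_count E k (H m)" if "m \<le> k" for m
    using that
  proof (induction m)
    case 0
    have "vol (H 0) = 1"
      unfolding vol_def by (rule prod.neutral) (use U in \<open>auto simp: H_def\<close>)
    then show ?case
      by (simp add: H_def)
  next
    case (Suc m)
    then have m: "m < k" by simp
    define D where "D = (H m)(m := U m - A m)"
    have H: "H m = (H m)(m := A m \<union> (U m - A m))" "H (Suc m) = (H m)(m := A m)"
      using A[OF m] by (auto simp: H_def fun_eq_iff)
    have fin: "finite (A m)" "finite (U m - A m)"
      using U[OF m] A[OF m] finite_subset by auto
    have cc: "clique_count E k (H m) = clique_count E k (H (Suc m)) + clique_count E k D"
      using clique_count_Un[OF m fin, of E "H m"] H by (simp add: D_def)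
    have v: "vol ((H m)(m := X)) = card X / card (U m) * (\<Prod>i\<in>{..<k} - {m}. card (H m i) / card (U i))" for X
      unfolding vol_def using m by (subst prod.remove[of _ m]) (auto intro!: prod.cong)
    have "card (A m \<union> (U m - A m)) = card (A m) + card (U m - A m)"
      by (rule card_Un_disjoint) (use fin in auto)
    then have vv: "vol (H m) = vol (H (Suc m)) + vol D"
      unfolding D_def by (subst H(1), subst H(2)) (simp only: v, simp add: add_divide_distrib distrib_right)
    have "clique_count E k D \<le> (vol D + \<alpha>) * clique_count E k U"
      unfolding vol_def by (rule upper) (use A in \<open>auto simp: D_def H_def\<close>)
    moreover have "(vol (H m) - m * \<alpha>) * clique_count E k U \<le> clique_count E k (H m)"
      using Suc by simp
    ultimately show ?case
      unfolding cc vv by (simp add: algebra_simps)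
  qed
  from this[of k] have "(vol (H k) - k * \<alpha>) * clique_count E k U \<le> clique_count E k (H k)"
    by simp
  moreover have "clique_count E k (H k) = clique_count E k A"
    by (rule clique_count_cong) (auto simp: H_def)
  moreover have "vol (H k) = vol A"
    by (auto simp: vol_def H_def intro: prod.cong)
  ultimately show ?thesis
    by (simp add: vol_def)
qed

text \<open>The box \<open>W\<close> maximizes the clique count divided by \<open>vol\<^bsup>1-\<alpha>\<^esup>\<close>. The exponent is slightly below 1,
  so that maximizers cannot be small.\<close>

lemma ex_regular_box:
  fixes U :: "nat \<Rightarrow> 'a set"
  assumes \<alpha>: "0 < \<alpha>" "\<alpha> \<le> 1" and D: "0 < D"
    and U: "\<And>i. i < k \<Longrightarrow> finite (U i) \<and> U i \<noteq> {}"
    and dense: "D * (\<Prod>i<k. real (card (U i))) \<le> clique_count E k U"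
  obtains W where "\<And>i. i < k \<Longrightarrow> W i \<subseteq> U i"
    "\<And>i. i < k \<Longrightarrow> D powr (1 / \<alpha>) * card (U i) \<le> card (W i)"
    "D * (\<Prod>i<k. real (card (W i))) \<le> clique_count E k W"
    "\<And>A. (\<And>i. i < k \<Longrightarrow> A i \<subseteq> W i) \<Longrightarrow>
      ((\<Prod>i<k. card (A i) / card (W i)) - k * \<alpha>) * clique_count E k W \<le> clique_count E k A"
proof -
  define vol where "vol W = (\<Prod>i<k. real (card (W i)))" for W :: "nat \<Rightarrow> 'a set"
  define \<Phi> where "\<Phi> W = clique_count E k W * vol W powr (\<alpha> - 1)" for W
  \<comment> \<open>Nonempty sides keep \<open>vol\<close> positive, and \<open>PiE\<close> makes
    the set of candidates finite; \<open>restr\<close> moves arbitrary boxes with nonempty sides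
    into it.\<close>
  define \<B> where "\<B> = PiE {..<k} (\<lambda>i. Pow (U i) - {{}})"
  have restr: "restrict A {..<k} \<in> \<B>" "\<Phi> (restrict A {..<k}) = \<Phi> A"
    if "\<And>i. i < k \<Longrightarrow> A i \<subseteq> U i \<and> A i \<noteq> {}" for A
  proof -
    show "restrict A {..<k} \<in> \<B>"
      using that by (auto simp: \<B>_def)
    have "clique_count E k (restrict A {..<k}) = clique_count E k A"
      by (rule clique_count_cong) auto
    then show "\<Phi> (restrict A {..<k}) = \<Phi> A"
      by (simp add: \<Phi>_def vol_def)
  qed
  have fin: "finite (\<Phi> ` \<B>)"
    using U by (auto simp: \<B>_def intro!: finite_PiE)
  have UB: "restrict U {..<k} \<in> \<B>" "\<Phi> (restrict U {..<k}) = \<Phi> U"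
    using restr[of U] U by auto
  then have "Max (\<Phi> ` \<B>) \<in> \<Phi> ` \<B>"
    by (intro Max_in fin) auto
  then obtain W where W: "W \<in> \<B>" "\<Phi> W = Max (\<Phi> ` \<B>)"
    by auto
  then have max: "\<Phi> A \<le> \<Phi> W" if "A \<in> \<B>" for A
    using that Max_ge[OF fin] by simp
  have WU: "W i \<subseteq> U i" "W i \<noteq> {}" "finite (W i)" "card (W i) > 0" if "i < k" for i
  proof -
    show *: "W i \<subseteq> U i" "W i \<noteq> {}"
      using W(1) that by (auto simp: \<B>_def PiE_iff)
    then show "finite (W i)"
      using U[OF that] finite_subset by blast
    with * show "card (W i) > 0"
      by (simp add: card_gt_0_iff)
  qed
  have Upos: "card (U i) > 0" if "i < k" for i
    using U[OF that] by (simp add: card_gt_0_iff)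
  have volpos: "vol U > 0" "vol W > 0"
    unfolding vol_def using WU(4) Upos by (auto intro!: prod_pos)
  have volle: "vol W \<le> vol U"
    unfolding vol_def using WU(1) U by (intro prod_mono) (simp add: card_mono)
  have split: "x * x powr (\<alpha> - 1) = x powr \<alpha>" "x powr \<alpha> * x powr (1 - \<alpha>) = x"
    "x powr (\<alpha> - 1) * x powr (1 - \<alpha>) = 1" if "x > 0" for x :: real
    using that by (simp_all add: powr_mult_base flip: powr_add)
  have "D * vol U powr \<alpha> \<le> \<Phi> U"
    using mult_right_mono[OF dense[folded vol_def], of "vol U powr (\<alpha> - 1)"] split(1)[OF volpos(1)]
    by (simp add: \<Phi>_def mult.assoc)
  also have "\<dots> \<le> \<Phi> W"
    using max UB by metis
  finally have DW: "D * vol U powr \<alpha> \<le> \<Phi> W" .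
  have \<Phi>W: "\<Phi> W * vol W powr (1 - \<alpha>) = clique_count E k W"
    unfolding \<Phi>_def using split(3)[OF volpos(2)] by (simp add: mult.assoc)
  have "D * vol W = D * vol W powr \<alpha> * vol W powr (1 - \<alpha>)"
    using split(2)[OF volpos(2)] by (simp add: mult.assoc)
  also have "\<dots> \<le> D * vol U powr \<alpha> * vol W powr (1 - \<alpha>)"
    using volpos volle \<alpha> D by (intro mult_right_mono mult_left_mono powr_mono2) auto
  also have "\<dots> \<le> clique_count E k W"
    using mult_right_mono[OF DW, of "vol W powr (1 - \<alpha>)"] \<Phi>W by simp
  finally have dens: "D * vol W \<le> clique_count E k W" .
  have "\<Phi> W \<le> vol W * vol W powr (\<alpha> - 1)"
    unfolding \<Phi>_def vol_def using WU by (intro mult_right_mono clique_count_le_prod) auto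
  with DW have "D * vol U powr \<alpha> \<le> vol W powr \<alpha>"
    using split(1)[OF volpos(2)] by simp
  \<comment> \<open>Undoing the power \<alpha> bounds the volume of \<open>W\<close> from below.
    Each side inherits the bound, since the other sides are no larger than in
    \<open>U\<close>.\<close>
  then have "(D powr (1 / \<alpha>) * vol U) powr \<alpha> \<le> vol W powr \<alpha>"
    using \<alpha> D by (simp add: powr_mult powr_powr)
  then have volW: "D powr (1 / \<alpha>) * vol U \<le> vol W"
    using powr_less_mono2[of \<alpha> "vol W" "D powr (1 / \<alpha>) * vol U"] \<alpha> volpos by force
  show ?thesis
  proof (rule that)
    show "D powr (1 / \<alpha>) * card (U i) \<le> card (W i)" if "i < k" for i
    proof -
      define P where "P W = (\<Prod>j\<in>{..<k} - {i}. real (card (W j)))" for W :: "nat \<Rightarrow> 'a set"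
      have vP: "vol W = card (W i) * P W" for W
        unfolding vol_def P_def using that by (subst prod.remove[of _ i]) auto
      have "P W \<le> P U"
        unfolding P_def using WU(1) U by (intro prod_mono) (simp add: card_mono)
      have "P U > 0"
        unfolding P_def using Upos by (intro prod_pos) auto
      have "D powr (1 / \<alpha>) * card (U i) * P U \<le> card (W i) * P W"
        using volW by (simp add: vP mult.assoc)
      also have "\<dots> \<le> card (W i) * P U"
        using \<open>P W \<le> P U\<close> by (simp add: mult_left_mono)
      finally show ?thesis
        using \<open>P U > 0\<close> by simp
    qed
    show "((\<Prod>i<k. card (A i) / card (W i)) - k * \<alpha>) * clique_count E k W \<le> clique_count E k A"
      if A: "\<And>i. i < k \<Longrightarrow> A i \<subseteq> W i" for A
    proof (rule clique_count_lower_regular[OF _ _ A])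
      fix A assume A: "\<And>i. i < k \<Longrightarrow> A i \<subseteq> W i"
      have fA: "finite (A i)" if "i < k" for i
        using A WU(3) that finite_subset by blast
      define r where "r = vol A / vol W"
      have r: "(\<Prod>i<k. card (A i) / card (W i)) = r"
        by (simp add: r_def vol_def prod_dividef)
      have "clique_count E k A \<le> (r + \<alpha>) * clique_count E k W"
      \<comment> \<open>A box with an empty side does not compete for the maximum, but its count
        vanishes.\<close>
      proof (cases "\<exists>i<k. A i = {}")
        case True
        then obtain i where "i < k" "A i = {}"
          by blast
        then have "(\<Prod>i<k. real (card (A i))) = 0"
          by (intro prod_zero bexI[of _ i]) auto
        then have "clique_count E k A \<le> 0"
          using clique_count_le_prod[of k A E] fA by metis
        moreover have "r \<ge> 0"
          by (simp add: r_def vol_def prod_nonneg)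
        ultimately show ?thesis
          using \<alpha> by (meson add_nonneg_nonneg clique_count_nonneg less_eq_real_def mult_nonneg_nonneg order_trans)
      next
        case False
        then have "vol A > 0"
          unfolding vol_def using fA by (intro prod_pos) (auto simp: card_gt_0_iff)
        then have "r > 0"
          using volpos by (simp add: r_def)
        have "\<Phi> A \<le> \<Phi> W"
          using restr[of A] A WU(1) False max by (metis subset_trans)
        then have "clique_count E k A * vol A powr (\<alpha> - 1) * vol A powr (1 - \<alpha>)
            \<le> clique_count E k W * vol W powr (\<alpha> - 1) * vol A powr (1 - \<alpha>)"
          by (simp add: \<Phi>_def mult_right_mono)
        then have "clique_count E k A \<le> clique_count E k W * (vol W powr (\<alpha> - 1) * vol A powr (1 - \<alpha>))"
          using split(3)[OF \<open>vol A > 0\<close>] by (simp add: mult.assoc)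
        also have "vol W powr (\<alpha> - 1) * vol A powr (1 - \<alpha>) = r powr (1 - \<alpha>)"
          using \<open>vol A > 0\<close> volpos powr_minus_divide[of "vol W" "1 - \<alpha>"] by (simp add: r_def powr_divide)
        also have "clique_count E k W * r powr (1 - \<alpha>) \<le> clique_count E k W * (r + \<alpha>)"
        proof (rule mult_left_mono[OF _ clique_count_nonneg])
          \<comment> \<open>Weighted AM-GM with second number 1 linearizes the power; this creates
            the additive error \<alpha>.\<close>
          have "r powr (1 - \<alpha>) \<le> (1 - \<alpha>) * r + \<alpha>"
            using Youngs_inequality_0[of "1 - \<alpha>" \<alpha> r 1] \<alpha> \<open>r > 0\<close> by simp
          also have "\<dots> \<le> r + \<alpha>"
            using \<alpha> \<open>r > 0\<close> by (simp add: algebra_simps)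
          finally show "r powr (1 - \<alpha>) \<le> r + \<alpha>" .
        qed
        finally show ?thesis
          by (simp add: mult.commute)
      qed
      then show "clique_count E k A \<le> ((\<Prod>i<k. card (A i) / card (W i)) + \<alpha>) * clique_count E k W"
        by (simp add: r)
    qed (use WU in auto)
  qed (use WU dens in \<open>auto simp: vol_def\<close>)
qed

text \<open>A regular box is extracted at the largest level \<open>j \<le> k\<close> whose clique
  density in \<open>R\<close> reaches a threshold. Missing the next threshold gives the last clause.
  The choice of \<sigma> precedes that of the graph and of \<open>R\<close>.\<close>

lemma ex_maximal_regular_box:
  fixes \<eta> :: real
  assumes \<eta>: "0 < \<eta>" "\<eta> \<le> 1"
  obtains \<sigma> :: real where "\<sigma> > 0"
    "\<And>(E :: 'a \<Rightarrow> 'a \<Rightarrow> bool) R. finite R \<Longrightarrow> R \<noteq> {} \<Longrightarrow> \<exists>j W. j \<le> k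
      \<and> (\<forall>i<j. W i \<subseteq> R \<and> \<sigma> * card R \<le> card (W i)) \<and> 0 < clique_count E j W
      \<and> (\<forall>A. (\<forall>i<j. A i \<subseteq> W i) \<longrightarrow>
          ((\<Prod>i<j. card (A i) / card (W i)) - \<eta>) * clique_count E j W \<le> clique_count E j A)
      \<and> (j < k \<longrightarrow> (\<Sum>u\<in>R. clique_count E j (\<lambda>i. W i \<inter> Collect (E u))) \<le> \<eta> * card R * clique_count E j W)"
proof -
  \<comment> \<open>This keeps the regularity error \<open>j * \<alpha>\<close> at most \<eta> for
    every \<open>j \<le> k\<close>.\<close>
  define \<alpha> where "\<alpha> = \<eta> / Suc k"
  define s where "s D = D powr (1 / \<alpha>)" for D :: real
  \<comment> \<open>The thresholds anticipate the loss \<open>s (C j) ^ j\<close> in the volume of a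
    box of level \<open>j\<close>. Missing the next threshold is then negligible even relative to
    the cliques of that smaller box.\<close>
  define C where "C = rec_nat 1 (\<lambda>j D. \<eta> * D * s D ^ j)"
  have C: "C 0 = 1" "C (Suc j) = \<eta> * C j * s (C j) ^ j" for j
    by (simp_all add: C_def)
  have \<alpha>: "0 < \<alpha>" "\<alpha> \<le> 1"
    using \<eta> by (auto simp: \<alpha>_def divide_simps)
  have s: "0 < s D" "s D \<le> 1" if "0 < D" "D \<le> 1" for D
    using that \<alpha> by (auto simp: s_def powr_le1)
  have Cpos: "0 < C j \<and> C j \<le> 1" for j
  proof (induction j)
    case (Suc j)
    then show ?case
      using s[of "C j"] \<eta> unfolding C by (auto intro!: mult_le_one power_le_one simp: less_imp_le)
  qed (simp add: C)
  have "C (Suc j) \<le> C j" for j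
    using Cpos[of j] s[of "C j"] \<eta> unfolding C
    by (intro order_trans[OF mult_left_le[of "s (C j) ^ j" "\<eta> * C j"]])
      (auto intro!: power_le_one mult_left_le_one_le simp: less_imp_le)
  then have Cmono: "C k \<le> C j" if "j \<le> k" for j
    using lift_Suc_antimono_le[of C j k] that by auto
  show ?thesis
  proof (rule that)
    show "s (C k) > 0"
      using s Cpos by auto
    fix E :: "'a \<Rightarrow> 'a \<Rightarrow> bool" and R :: "'a set"
    assume R: "finite R" "R \<noteq> {}"
    define Q where "Q j \<longleftrightarrow> j \<le> k \<and> C j * card R ^ j \<le> clique_count E j (\<lambda>_. R)" for j
    define j where "j = Greatest Q"
    have "Q 0"
      by (simp add: Q_def C)
    moreover have "i \<le> k" if "Q i" for i
      using that by (simp add: Q_def)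
    ultimately have "Q j" and jmax: "\<And>i. Q i \<Longrightarrow> i \<le> j"
      unfolding j_def using GreatestI_nat[of Q 0 k] Greatest_le_nat[of Q _ k] by blast+
    then have jk: "j \<le> k" and dens: "C j * card R ^ j \<le> clique_count E j (\<lambda>_. R)"
      by (auto simp: Q_def)
    obtain W where W: "\<And>i. i < j \<Longrightarrow> W i \<subseteq> R"
      "\<And>i. i < j \<Longrightarrow> C j powr (1 / \<alpha>) * card R \<le> card (W i)"
      "C j * (\<Prod>i<j. real (card (W i))) \<le> clique_count E j W"
      "\<And>A. (\<And>i. i < j \<Longrightarrow> A i \<subseteq> W i) \<Longrightarrow>
        ((\<Prod>i<j. card (A i) / card (W i)) - j * \<alpha>) * clique_count E j W \<le> clique_count E j A"
      by (rule ex_regular_box[OF \<alpha>, of "C j" j "\<lambda>_. R" E]) (use Cpos R dens in auto)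
    have cR: "real (card R) > 0"
      using R by (simp add: card_gt_0_iff)
    have sj: "s (C j) * card R \<le> card (W i)" if "i < j" for i
      using W(2)[OF that] by (simp add: s_def)
    have spos: "s (C j) > 0"
      using s Cpos by auto
    have "(s (C j) * card R) ^ j = (\<Prod>i<j. s (C j) * card R)"
      by simp
    also have "\<dots> \<le> (\<Prod>i<j. real (card (W i)))"
      using sj spos by (intro prod_mono) (auto simp: less_imp_le)
    finally have vol: "C j * (s (C j) * card R) ^ j \<le> clique_count E j W"
      using W(3) Cpos[of j] by (meson less_imp_le mult_left_mono order_trans)
    have "j * \<alpha> \<le> \<eta>"
    proof -
      have "real j * \<alpha> \<le> Suc k * \<alpha>"
        using jk \<alpha> by (intro mult_right_mono) auto
      then show ?thesis
        by (simp add: \<alpha>_def)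
    qed
    have few: "(\<Sum>u\<in>R. clique_count E j (\<lambda>i. W i \<inter> Collect (E u))) \<le> \<eta> * card R * clique_count E j W"
      if "j < k"
    proof -
      have "\<not> Q (Suc j)"
        using jmax[of "Suc j"] by auto
      then have "clique_count E (Suc j) (\<lambda>_. R) \<le> C (Suc j) * card R ^ Suc j"
        using that by (simp add: Q_def)
      also have "\<dots> = \<eta> * card R * (C j * (s (C j) * card R) ^ j)"
        by (simp add: C power_mult_distrib mult_ac)
      also have "\<dots> \<le> \<eta> * card R * clique_count E j W"
        using vol \<eta> by (intro mult_left_mono) auto
      finally have "clique_count E (Suc j) (\<lambda>_. R) \<le> \<eta> * card R * clique_count E j W" .
      moreover have "(\<Sum>u\<in>R. clique_count E j (\<lambda>i. W i \<inter> Collect (E u))) \<le> clique_count E (Suc j) (\<lambda>_. R)"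
        unfolding clique_count.simps using R(1) by (intro sum_mono clique_count_mono) (use W(1) in auto)
      ultimately show ?thesis
        by simp
    qed
    have low: "((\<Prod>i<j. card (A i) / card (W i)) - \<eta>) * clique_count E j W \<le> clique_count E j A"
      if "\<forall>i<j. A i \<subseteq> W i" for A
      using W(4)[of A] that \<open>j * \<alpha> \<le> \<eta>\<close> clique_count_nonneg[of E j W]
      by (meson diff_left_mono mult_right_mono order_trans)
    have "s (C k) \<le> s (C j)"
      unfolding s_def using Cmono[OF jk] Cpos[of k] \<alpha> by (intro powr_mono2) auto
    then have "s (C k) * card R \<le> card (W i)" if "i < j" for i
      using sj[OF that] by (meson mult_right_mono of_nat_0_le_iff order_trans)
    moreover have "0 < clique_count E j W"
      using vol Cpos[of j] spos cR by (smt (verit) mult_pos_pos zero_less_power)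
    ultimately show "\<exists>j W. j \<le> k
      \<and> (\<forall>i<j. W i \<subseteq> R \<and> s (C k) * card R \<le> card (W i)) \<and> 0 < clique_count E j W
      \<and> (\<forall>A. (\<forall>i<j. A i \<subseteq> W i) \<longrightarrow>
          ((\<Prod>i<j. card (A i) / card (W i)) - \<eta>) * clique_count E j W \<le> clique_count E j A)
      \<and> (j < k \<longrightarrow> (\<Sum>u\<in>R. clique_count E j (\<lambda>i. W i \<inter> Collect (E u))) \<le> \<eta> * card R * clique_count E j W)"
      using jk W(1) few low by (intro exI[of _ j] exI[of _ W]) simp
  qed
qed

subsection \<open>Average page density\<close>

text \<open>On the unit interval the \<open>k\<close>-th power is Lipschitz with constant
  \<open>k\<close>. If \<open>b\<close> exceeds 1, then \<open>a \<le> b\<close> and monotonicity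
  suffices.\<close>

lemma power_ge_power_minus:
  fixes a b d :: real
  assumes "0 \<le> a" "a \<le> 1" "0 \<le> b" "a - d \<le> b" "0 \<le> d"
  shows "a ^ k - k * d \<le> b ^ k"
proof (cases "a \<le> b")
  case True
  then have "a ^ k \<le> b ^ k"
    using assms by (intro power_mono)
  then show ?thesis
    using assms(5) by (simp add: add_increasing2 diff_le_eq)
next
  case False
  show ?thesis
  proof (induction k)
    case (Suc k)
    have "a ^ Suc k - b ^ Suc k = a * (a ^ k - b ^ k) + b ^ k * (a - b)"
      by (simp add: algebra_simps)
    also have "a * (a ^ k - b ^ k) \<le> 1 * (k * d)"
      using Suc assms False by (intro mult_mono) (auto intro!: mult_nonneg_nonneg power_mono)
    also have "b ^ k * (a - b) \<le> 1 * d"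
      using assms False by (intro mult_mono power_le_one) auto
    finally show ?case
      by (simp add: algebra_simps)
  qed simp
qed

lemma convex_on_power_nonneg: "convex_on {0::real..} (\<lambda>x. x ^ k)"
  by (cases "even k") (auto intro: convex_on_subset[OF convex_power_even] convex_power_odd)

text \<open>For finite nonempty \<open>W\<close> this is the expected number of vertices of
  \<open>V\<close> adjacent to all of \<open>k\<close> independent uniform vertices of
  \<open>W\<close>. For empty \<open>W\<close> the quotient is 0, so the value is 0 once
  \<open>k \<ge> 1\<close>.\<close>

definition page_avg :: "('a \<Rightarrow> 'a \<Rightarrow> bool) \<Rightarrow> 'a set \<Rightarrow> nat \<Rightarrow> 'a set \<Rightarrow> real" where
  "page_avg E V k W = (\<Sum>u\<in>V. (card (W \<inter> Collect (E u)) / card W) ^ k)"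

text \<open>The density of a vertex to the union is the size-weighted mean of its densities to
  \<open>A\<close> and \<open>B\<close>, and the \<open>k\<close>-th power is convex on nonnegative
  numbers.\<close>

lemma page_avg_Un_le:
  assumes "finite A" "finite B" "A \<inter> B = {}" "page_avg E V k A \<le> b" "page_avg E V k B \<le> b"
  shows "page_avg E V k (A \<union> B) \<le> b"
proof (cases "A = {} \<or> B = {}")
  case False
  define t where "t = card B / (real (card A) + card B)"
  define d where "d W u = card (W \<inter> Collect (E u)) / card W" for W u
  have pos: "card A > 0" "card B > 0"
    using assms False by (auto simp: card_gt_0_iff)
  have t: "0 \<le> t" "t \<le> 1" "1 - t = card A / (real (card A) + card B)"
    using pos by (auto simp: t_def divide_simps)
  have "d (A \<union> B) u ^ k \<le> (1 - t) * d A u ^ k + t * d B u ^ k" for u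
  proof -
    have "card ((A \<union> B) \<inter> Collect (E u)) = card (A \<inter> Collect (E u)) + card (B \<inter> Collect (E u))"
      unfolding Int_Un_distrib2 using assms by (intro card_Un_disjoint) auto
    then have "d (A \<union> B) u = (1 - t) * d A u + t * d B u"
      using pos assms unfolding t(3) by (simp add: t_def d_def card_Un_disjoint add_divide_distrib)
    then show ?thesis
      using convex_onD[OF convex_on_power_nonneg t(1,2), of "d A u" "d B u" k] by (simp add: d_def)
  qed
  then have "page_avg E V k (A \<union> B) \<le> (\<Sum>u\<in>V. (1 - t) * d A u ^ k + t * d B u ^ k)"
    unfolding page_avg_def d_def by (rule sum_mono)
  also have "\<dots> = (1 - t) * page_avg E V k A + t * page_avg E V k B"
    by (simp add: page_avg_def d_def sum.distrib sum_distrib_left)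
  also have "\<dots> \<le> (1 - t) * b + t * b"
    using t assms by (intro add_mono mult_left_mono) auto
  finally show ?thesis
    by (simp add: algebra_simps)
qed (use assms in auto)

text \<open>Choosing a vertex of a clique removes only that vertex from the candidates. The
  resulting falling factorial is rounded down to a power, with truncated subtraction for small
  \<open>A\<close>.\<close>

lemma clique_count_clique_ge:
  assumes "finite A" "\<And>u v. u \<in> A \<Longrightarrow> v \<in> A \<Longrightarrow> u \<noteq> v \<Longrightarrow> E u v" "\<And>u. \<not> E u u"
  shows "real (card A - k) ^ k \<le> clique_count E k (\<lambda>_. A)"
  using assms
proof (induction k arbitrary: A)
  case (Suc k)
  have "real (card A - Suc k) ^ k \<le> clique_count E k (\<lambda>_. A \<inter> Collect (E u))" if "u \<in> A" for u
  proof -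
    have "A \<inter> Collect (E u) = A - {u}"
      using Suc.prems that by auto
    then show ?thesis
      using Suc.IH[of "A - {u}"] Suc.prems that by simp
  qed
  then have "card A * real (card A - Suc k) ^ k \<le> clique_count E (Suc k) (\<lambda>_. A)"
    using sum_bounded_below[of A "real (card A - Suc k) ^ k"] by simp
  moreover have "real (card A - Suc k) ^ Suc k \<le> card A * real (card A - Suc k) ^ k"
    by (simp add: mult_right_mono)
  ultimately show ?case
    by linarith
qed simp

text \<open>In a large clique almost all \<open>k\<close>-tuples are ordered cliques, so powers of
  densities are nearly normalized clique counts, to which double counting applies. The discrepancy
  is at most \<open>real k ^ 2 / card W\<close> per vertex.\<close>

lemma page_avg_clique_le:
  assumes sym: "\<And>u v. E u v \<Longrightarrow> E v u" and irr: "\<And>u. \<not> E u u" and "finite V"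
    and pages: "\<And>S. S \<subseteq> V \<Longrightarrow> card S = k \<Longrightarrow> (\<And>s t. s \<in> S \<Longrightarrow> t \<in> S \<Longrightarrow> s \<noteq> t \<Longrightarrow> E s t)
      \<Longrightarrow> card {u \<in> V. \<forall>s\<in>S. E s u} \<le> n"
    and W: "W \<subseteq> V" "W \<noteq> {}" and clique: "\<And>u v. u \<in> W \<Longrightarrow> v \<in> W \<Longrightarrow> u \<noteq> v \<Longrightarrow> E u v"
  shows "page_avg E V k W \<le> n + card V * (real k ^ 2 / card W)"
proof -
  define M where "M = real (card W)"
  have "finite W"
    using W \<open>finite V\<close> finite_subset by blast
  then have M: "M > 0"
    using W by (simp add: M_def card_gt_0_iff)
  have "(card (W \<inter> Collect (E u)) / M) ^ k
      \<le> clique_count E k (\<lambda>_. W \<inter> Collect (E u)) / M ^ k + real k ^ 2 / M" for u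
  proof -
    define A where "A = W \<inter> Collect (E u)"
    have "card A \<le> card W"
      unfolding A_def using \<open>finite W\<close> by (intro card_mono) auto
    then have "(card A / M) ^ k - k * (k / M) \<le> (real (card A - k) / M) ^ k"
      using M by (intro power_ge_power_minus) (auto simp: M_def divide_simps)
    moreover have "(real (card A - k) / M) ^ k \<le> clique_count E k (\<lambda>_. A) / M ^ k"
      unfolding power_divide using M clique irr \<open>finite W\<close>
      by (intro divide_right_mono clique_count_clique_ge) (auto simp: A_def)
    ultimately show ?thesis
      unfolding A_def by (simp add: power2_eq_square)
  qed
  then have "page_avg E V k W \<le> (\<Sum>u\<in>V. clique_count E k (\<lambda>_. W \<inter> Collect (E u)) / M ^ k + real k ^ 2 / M)"
    unfolding page_avg_def M_def by (rule sum_mono)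
  also have "\<dots> = (\<Sum>u\<in>V. clique_count E k (\<lambda>_. W \<inter> Collect (E u))) / M ^ k + card V * (real k ^ 2 / M)"
    by (simp add: sum.distrib sum_divide_distrib)
  also have "(\<Sum>u\<in>V. clique_count E k (\<lambda>_. W \<inter> Collect (E u))) \<le> n * clique_count E k (\<lambda>_. W)"
    by (rule sum_clique_count_le[OF sym irr \<open>finite V\<close> pages W(1)])
  also have "clique_count E k (\<lambda>_. W) \<le> M ^ k"
    using clique_count_le_prod[of k "\<lambda>_. W" E] \<open>finite W\<close> by (simp add: M_def)
  finally show ?thesis
    using M by (simp add: M_def divide_right_mono mult_left_mono)
qed

text \<open>Take a maximal set \<open>B\<close> that is hereditarily exhausted by \<open>False\<close>-sets. If a subset of \<open>V - B\<close> leaves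
  a large remainder after removing a maximal \<open>True\<close>-set, that remainder contains no \<open>True\<close>-set at all and
  could be added to \<open>B\<close>. So either \<open>B\<close> or \<open>V - B\<close> will do.\<close>

lemma ex_hereditary_region:
  fixes P :: "bool \<Rightarrow> 'a set \<Rightarrow> bool" and \<beta> :: real
  assumes V: "finite V" and empty: "\<And>c. P c {}"
    and union: "\<And>c A B. A \<subseteq> V \<Longrightarrow> B \<subseteq> V \<Longrightarrow> P c A \<Longrightarrow> P c B \<Longrightarrow> A \<inter> B = {} \<Longrightarrow> P c (A \<union> B)"
    and ex: "\<And>S. S \<subseteq> V \<Longrightarrow> r \<le> card S \<Longrightarrow> \<exists>c W. W \<subseteq> S \<and> W \<noteq> {} \<and> P c W"
    and \<beta>: "0 < \<beta>" "real r \<le> \<beta>\<^sup>2 * card V"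
  obtains c R where "R \<subseteq> V" "card V \<le> 2 * card R"
    "\<And>S. S \<subseteq> R \<Longrightarrow> \<exists>W\<subseteq>S. P c W \<and> card S - \<beta> * card V \<le> card W"
proof -
  have fin: "finite S" if "S \<subseteq> V" for S
    using that V finite_subset by blast
  have max: "\<exists>X\<subseteq>S. Q X \<and> (\<forall>Y\<subseteq>S. Q Y \<longrightarrow> card Y \<le> card X)" if "S \<subseteq> V" "Q {}" for S and Q :: "'a set \<Rightarrow> bool"
  proof -
    have "\<exists>X. (X \<subseteq> S \<and> Q X) \<and> (\<forall>Y. Y \<subseteq> S \<and> Q Y \<longrightarrow> card Y \<le> card X)"
    proof (rule Lattices_Big.ex_has_greatest_nat)
      show "{} \<subseteq> S \<and> Q {}"
        using that by simp
      show "\<forall>Y. Y \<subseteq> S \<and> Q Y \<longrightarrow> card Y < Suc (card S)"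
        using fin[OF \<open>S \<subseteq> V\<close>] by (simp add: card_mono less_Suc_eq_le)
    qed
    then show ?thesis
      by blast
  qed
  \<comment> \<open>Measuring the loss by \<open>card B\<close> instead of \<open>card V\<close>
    makes it additive, so that \<open>Q\<close> survives the disjoint union formed below.\<close>
  define Q where "Q B \<longleftrightarrow> (\<forall>S\<subseteq>B. \<exists>W\<subseteq>S. P False W \<and> card S - \<beta> * card B \<le> card W)" for B
  have "Q {}"
    using empty by (auto simp: Q_def)
  then obtain B where B: "B \<subseteq> V" "Q B" and Bmax: "\<And>Y. Y \<subseteq> V \<Longrightarrow> Q Y \<Longrightarrow> card Y \<le> card B"
    using max[of V Q] by blast
  have red: "\<exists>W\<subseteq>S. P True W \<and> card S - \<beta> * card V \<le> card W" if S: "S \<subseteq> V - B" for S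
  proof -
    obtain X where X: "X \<subseteq> S" "P True X" and Xmax: "\<And>Y. Y \<subseteq> S \<Longrightarrow> P True Y \<Longrightarrow> card Y \<le> card X"
      using max[of S "P True"] empty S by blast
    have XV: "X \<subseteq> V" "finite X"
      using X S fin by blast+
    have nored: "\<not> P True Y" if "Y \<subseteq> S - X" "Y \<noteq> {}" for Y
    proof
      assume "P True Y"
      have YV: "Y \<subseteq> V" "finite Y"
        using that S fin by blast+
      then have "P True (X \<union> Y)"
        using union[of X Y True] X XV \<open>P True Y\<close> that by blast
      then have "card (X \<union> Y) \<le> card X"
        using Xmax X that by blast
      moreover have "card (X \<union> Y) = card X + card Y"
        using XV YV that by (intro card_Un_disjoint) auto
      ultimately show False
        using YV that by simp
    qed
    have "card (S - X) < \<beta> * card V"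
    proof (rule ccontr)
      assume "\<not> ?thesis"
      then have large: "\<beta> * card V \<le> card (S - X)"
        by simp
      have SXV: "S - X \<subseteq> V" "(S - X) \<inter> B = {}"
        using S by auto
      have SX: "\<exists>W\<subseteq>T. P False W \<and> card T - \<beta> * card (S - X) \<le> card W" if T: "T \<subseteq> S - X" for T
      proof -
        have TV: "T \<subseteq> V"
          using T SXV by blast
        obtain Z where Z: "Z \<subseteq> T" "P False Z" and Zmax: "\<And>Y. Y \<subseteq> T \<Longrightarrow> P False Y \<Longrightarrow> card Y \<le> card Z"
          using max[of T "P False"] empty TV by blast
        have ZV: "Z \<subseteq> V" "finite Z"
          using Z TV fin by blast+
        have "card (T - Z) < r"
        proof (rule ccontr)
          assume "\<not> ?thesis"
          then obtain c Y where Y: "Y \<subseteq> T - Z" "Y \<noteq> {}" "P c Y"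
            using ex[of "T - Z"] TV by auto
          have YV: "Y \<subseteq> V" "finite Y"
            using Y TV fin by blast+
          have "c = False"
            using Y nored[of Y] T by (cases c) auto
          then have "P False (Z \<union> Y)"
            using union[of Z Y False] Z ZV Y YV by blast
          then have "card (Z \<union> Y) \<le> card Z"
            using Zmax Z Y by blast
          moreover have "card (Z \<union> Y) = card Z + card Y"
            using ZV YV Y by (intro card_Un_disjoint) auto
          ultimately show False
            using YV Y by simp
        qed
        \<comment> \<open>One factor \<beta> is the permitted relative loss; the other passes from
          \<open>card V\<close> to \<open>card (S - X)\<close> through \<open>large\<close>.\<close>
        then have "real (card (T - Z)) \<le> \<beta> * (\<beta> * card V)"
          using \<beta> by (simp add: power2_eq_square mult.assoc)
        also have "\<dots> \<le> \<beta> * card (S - X)"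
          using large \<beta> by (intro mult_left_mono) auto
        finally show ?thesis
          using Z ZV card_mono[OF fin[OF TV] Z(1)]
          by (intro exI[of _ Z] conjI) (simp_all add: card_Diff_subset of_nat_diff)
      qed
      have cardB: "card (B \<union> (S - X)) = card B + card (S - X)"
        using fin B SXV by (intro card_Un_disjoint) auto
      have "Q (B \<union> (S - X))"
        unfolding Q_def
      proof (intro allI impI)
        fix T assume T: "T \<subseteq> B \<union> (S - X)"
        obtain W1 where W1: "W1 \<subseteq> T \<inter> B" "P False W1" "card (T \<inter> B) - \<beta> * card B \<le> card W1"
          using B(2) Int_lower2[of T B] unfolding Q_def by blast
        obtain W2 where W2: "W2 \<subseteq> T \<inter> (S - X)" "P False W2" "card (T \<inter> (S - X)) - \<beta> * card (S - X) \<le> card W2"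
          using SX[OF Int_lower2[of T "S - X"]] by blast
        have "W1 \<subseteq> V" "W2 \<subseteq> V" "W1 \<inter> W2 = {}"
          using W1(1) W2(1) B(1) SXV by blast+
        then have "P False (W1 \<union> W2)" "card (W1 \<union> W2) = card W1 + card W2"
          using union[of W1 W2 False] W1(2) W2(2) card_Un_disjoint[of W1 W2] fin by blast+
        moreover have "card T = card (T \<inter> B) + card (T \<inter> (S - X))"
        proof -
          have "T = T \<inter> B \<union> T \<inter> (S - X)"
            using T by blast
          have "T \<subseteq> V"
            using T B(1) SXV by blast
          then have "finite (T \<inter> B)" "finite (T \<inter> (S - X))" "(T \<inter> B) \<inter> (T \<inter> (S - X)) = {}"
            using SXV fin by blast+
          then show ?thesis
            using \<open>T = T \<inter> B \<union> T \<inter> (S - X)\<close> card_Un_disjoint by metis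
        qed
        ultimately show "\<exists>W\<subseteq>T. P False W \<and> card T - \<beta> * card (B \<union> (S - X)) \<le> card W"
          using W1(1,3) W2(1,3) unfolding cardB
          by (intro exI[of _ "W1 \<union> W2"] conjI) (blast, assumption, simp add: algebra_simps)
      qed
      \<comment> \<open>Maximality of \<open>B\<close> leaves only the degenerate case of empty
        \<open>V\<close>. Then \<open>r = 0\<close>, and \<open>ex\<close> would supply a nonempty
        subset of the empty set.\<close>
      then have "card (S - X) = 0"
        using Bmax[of "B \<union> (S - X)"] B(1) SXV(1) cardB by simp
      then have "S - X = {}"
        using fin[OF SXV(1)] by simp
      moreover have "card V = 0"
        using large \<open>card (S - X) = 0\<close> \<beta> by (simp add: mult_le_0_iff)
      ultimately have "r = 0"
        using \<beta> by simp
      then show False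
        using ex[of "{}"] by auto
    qed
    then show ?thesis
      using X XV card_mono[OF _ X(1)] fin[of S] S
      by (intro exI[of _ X] conjI) (simp_all add: card_Diff_subset of_nat_diff subset_iff)
  qed
  show ?thesis
  proof (cases "card V \<le> 2 * card B")
    case True
    have "\<exists>W\<subseteq>S. P False W \<and> card S - \<beta> * card V \<le> card W" if "S \<subseteq> B" for S
    proof -
      have "\<beta> * card B \<le> \<beta> * card V"
        using \<beta> B V by (simp add: card_mono)
      then show ?thesis
        using B(2) that unfolding Q_def by (smt (verit))
    qed
    then show ?thesis
      using that[OF B(1) True] by blast
  next
    case False
    then have "card V \<le> 2 * card (V - B)"
      using B V fin by (simp add: card_Diff_subset)
    then show ?thesis
      using that[of "V - B" True] red by simp
  qed
qed

subsection \<open>A sharp inequality\<close>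

text \<open>With \<open>w = 1 + s\<close> this is the range \<open>w \<ge> 1\<close> of the estimate
  \<open>1 \<le> (2 - w) ^ k + k * ln w\<close>. Equality holds at \<open>s = 0\<close>, and the
  derivative has the right sign by
  \<open>(1 - t) ^ (k - 1) \<le> 1 - t \<le> 1 / (1 + t)\<close>.\<close>

lemma Bernoulli_ln_lower:
  fixes s :: real
  assumes "0 \<le> s" "s \<le> 1" "2 \<le> k"
  shows "1 - k * ln (1 + s) \<le> (1 - s) ^ k"
proof -
  define f where "f t = (1 - t) ^ k + k * ln (1 + t)" for t :: real
  have "\<exists>y. (f has_real_derivative y) (at t) \<and> 0 \<le> y" if "0 \<le> t" "t \<le> s" for t
  proof -
    have "(1 - t) ^ (k - 1) \<le> (1 - t) ^ 1"
      using that assms by (intro power_decreasing) auto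
    also have "\<dots> \<le> 1 / (1 + t)"
      using that by (simp add: field_simps)
    finally have "0 \<le> real k * (1 / (1 + t) - (1 - t) ^ (k - 1))"
      by simp
    moreover have "(f has_real_derivative real k * (1 / (1 + t) - (1 - t) ^ (k - 1))) (at t)"
      unfolding f_def using that by (auto intro!: derivative_eq_intros simp: algebra_simps)
    ultimately show ?thesis
      by blast
  qed
  then have "f 0 \<le> f s"
    by (rule DERIV_nonneg_imp_nondecreasing[OF assms(1)])
  then show ?thesis
    by (simp add: f_def)
qed

text \<open>The same estimate below 1, with \<open>w = 1 - s\<close>. Monotonicity rests on
  \<open>1 \<le> (1 + t) ^ 3 * (1 - t)\<close>, which holds up to \<open>t = 7 / 10\<close>; the
  exponent 3 comes from \<open>4 \<le> k\<close>.\<close>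

lemma Bernoulli_ln_upper:
  fixes s :: real
  assumes "0 \<le> s" "s \<le> 7 / 10" "4 \<le> k"
  shows "1 - k * ln (1 - s) \<le> (1 + s) ^ k"
proof -
  define f where "f t = (1 + t) ^ k + k * ln (1 - t)" for t :: real
  have "\<exists>y. (f has_real_derivative y) (at t) \<and> 0 \<le> y" if "0 \<le> t" "t \<le> s" for t
  proof -
    have t: "t \<le> 7 / 10"
      using that assms by simp
    have "1 \<le> (1 + t) ^ 3 * (1 - t)"
    proof -
      have "0 \<le> t * (2 - 2 * t\<^sup>2 - t ^ 3)"
      proof (rule mult_nonneg_nonneg)
        have "t ^ 2 \<le> (7 / 10) ^ 2" "t ^ 3 \<le> (7 / 10) ^ 3"
          using that t by (intro power_mono; simp)+
        then show "0 \<le> 2 - 2 * t\<^sup>2 - t ^ 3"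
          by (simp add: power_divide)
      qed (use that in simp)
      then show ?thesis
        by (simp add: algebra_simps power2_eq_square power3_eq_cube)
    qed
    also have "\<dots> \<le> (1 + t) ^ (k - 1) * (1 - t)"
      using that t assms by (intro mult_right_mono power_increasing) auto
    finally have "1 / (1 - t) \<le> (1 + t) ^ (k - 1)"
      using t by (simp add: divide_simps)
    then have "0 \<le> real k * ((1 + t) ^ (k - 1) - 1 / (1 - t))"
      by simp
    moreover have "(f has_real_derivative real k * ((1 + t) ^ (k - 1) - 1 / (1 - t))) (at t)"
      unfolding f_def using t by (auto intro!: derivative_eq_intros simp: algebra_simps)
    ultimately show ?thesis
      by blast
  qed
  then have "f 0 \<le> f s"
    by (rule DERIV_nonneg_imp_nondecreasing[OF assms(1)])
  then show ?thesis
    by (simp add: f_def)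
qed

text \<open>Equality holds at \<open>x\<^sub>i = 1/2\<close>. For \<open>k \<ge> 4\<close> put \<open>w\<^sub>i = 2 x\<^sub>i\<close> and combine \<open>\<Prod>w\<^sub>i \<ge> 1 + \<Sum> ln w\<^sub>i\<close> with
  \<open>(2 - w)\<^sup>k / k + ln w \<ge> 1/k\<close>. The latter fails for small \<open>w\<close>, but there a single summand \<open>(2 - w\<^sub>i)\<^sup>k / k\<close>
  already exceeds 2. For \<open>k = 3\<close> these two ranges leave a gap,
  hence the separate treatment.\<close>

lemma prod_power_ineq:
  fixes x :: "nat \<Rightarrow> real"
  assumes x: "\<And>i. i < k \<Longrightarrow> 0 \<le> x i \<and> x i \<le> 1" and "1 \<le> k"
  shows "2 \<le> 2 ^ k * ((\<Prod>i<k. x i) + (\<Sum>i<k. (1 - x i) ^ k) / k)"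
proof -
  consider "k = 1" | "k = 2" | "k = 3" | "4 \<le> k"
    using \<open>1 \<le> k\<close> by linarith
  then show ?thesis
  proof cases
    case 1
    then show ?thesis by simp
  next
    case 2
    have "0 \<le> (x 0 + x 1 - 1)\<^sup>2"
      by simp
    then show ?thesis
      using 2 by (simp add: lessThan_Suc numeral_2_eq_2 field_simps)
  next
    case 3
    \<comment> \<open>Elementary symmetric polynomials of the numbers \<open>1 - x i\<close>; the
      third one cancels in \<open>eq\<close>. The bound \<open>0 \<le> q\<close> serves for
      \<open>s \<le> 1\<close> and the upper bound on \<open>q\<close> beyond, where a square
      centred at \<open>3 / 2\<close> remains.\<close>
    define s where "s = (1 - x 0) + (1 - x 1) + (1 - x 2)"
    define q where "q = (1 - x 0) * (1 - x 1) + (1 - x 0) * (1 - x 2) + (1 - x 1) * (1 - x 2)"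
    have xs: "0 \<le> 1 - x 0" "0 \<le> 1 - x 1" "0 \<le> 1 - x 2"
      using x[of 0] x[of 1] x[of 2] 3 by auto
    have eq: "(\<Prod>i<k. x i) + (\<Sum>i<k. (1 - x i) ^ k) / k = 1 - s + s ^ 3 / 3 + q * (1 - s)"
      using 3 by (simp add: s_def q_def numeral_3_eq_3 numeral_2_eq_2 field_simps)
    have q: "0 \<le> q" "q \<le> s\<^sup>2 / 3"
    proof -
      show "0 \<le> q"
        unfolding q_def using xs by (intro add_nonneg_nonneg mult_nonneg_nonneg)
      have "0 \<le> ((x 0 - x 1)\<^sup>2 + (x 0 - x 2)\<^sup>2 + (x 1 - x 2)\<^sup>2)"
        by simp
      then show "q \<le> s\<^sup>2 / 3"
        by (simp add: q_def s_def power2_eq_square algebra_simps)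
    qed
    have "1 / 4 \<le> 1 - s + s ^ 3 / 3 + q * (1 - s)"
    proof (cases "s \<le> 1")
      case True
      have "0 \<le> (1 - s)\<^sup>2 * (s + 2)"
        using xs by (intro mult_nonneg_nonneg) (auto simp: s_def)
      then have "1 / 3 \<le> 1 - s + s ^ 3 / 3"
        by (simp add: power2_eq_square power3_eq_cube algebra_simps)
      moreover have "0 \<le> q * (1 - s)"
        using q True by simp
      ultimately show ?thesis by linarith
    next
      case False
      then have "s\<^sup>2 / 3 * (1 - s) \<le> q * (1 - s)"
        using q by (intro mult_right_mono_neg) auto
      moreover have "0 \<le> (s - 3 / 2)\<^sup>2"
        by simp
      ultimately show ?thesis
        by (simp add: power2_eq_square power3_eq_cube field_simps)
    qed
    then show ?thesis
      unfolding eq using 3 by simp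
  next
    case 4
    define w where "w i = 2 * x i" for i
    have w: "0 \<le> w i \<and> w i \<le> 2" if "i < k" for i
      using x that by (simp add: w_def)
    have two: "(2 - w i) ^ k = 2 ^ k * (1 - x i) ^ k" for i
      by (simp add: w_def algebra_simps flip: power_mult_distrib)
    have eq: "2 ^ k * ((\<Prod>i<k. x i) + (\<Sum>i<k. (1 - x i) ^ k) / k)
        = (\<Prod>i<k. w i) + (\<Sum>i<k. (2 - w i) ^ k) / k"
      by (simp add: two distrib_left prod.distrib flip: sum_distrib_left, simp add: w_def prod.distrib)
    have P: "0 \<le> (\<Prod>i<k. w i)"
      using w by (intro prod_nonneg) auto
    show ?thesis
    \<comment> \<open>The cut at \<open>17 / 10 = 1 + 7 / 10\<close> matches the range of
      \<open>Bernoulli_ln_upper\<close>, and \<open>(17 / 10) ^ 4\<close> just exceeds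
      \<open>2 * 4\<close>.\<close>
    proof (cases "\<exists>i<k. 17 / 10 \<le> 2 - w i")
      case True
      then obtain i where i: "i < k" "17 / 10 \<le> 2 - w i"
        by blast
      have "2 * real k \<le> (17 / 10) ^ k"
        using 4 by (induction k rule: dec_induct) (auto simp: power_divide)
      also have "\<dots> \<le> (2 - w i) ^ k"
        using i by (intro power_mono) auto
      also have "\<dots> \<le> (\<Sum>i<k. (2 - w i) ^ k)"
        using i w by (intro member_le_sum) auto
      finally have "2 \<le> (\<Sum>i<k. (2 - w i) ^ k) / k"
        using 4 by (simp add: field_simps)
      then show ?thesis
        unfolding eq using P by simp
    next
      case False
      then have w': "3 / 10 \<le> w i" if "i < k" for i
        using that by force
      have G: "1 \<le> (2 - w i) ^ k + k * ln (w i)" if "i < k" for i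
      proof (cases "1 \<le> w i")
        case True
        then show ?thesis
          using Bernoulli_ln_lower[of "w i - 1" k] w[OF that] 4 by (simp add: algebra_simps)
      next
        case False
        then show ?thesis
          using Bernoulli_ln_upper[of "1 - w i" k] w'[OF that] 4 by (simp add: algebra_simps)
      qed
      have "1 + (\<Sum>i<k. ln (w i)) \<le> exp (\<Sum>i<k. ln (w i))"
        by (rule exp_ge_add_one_self)
      also have "\<dots> = (\<Prod>i<k. w i)"
        unfolding exp_sum[OF finite_lessThan] using w' by (intro prod.cong) (auto simp: exp_ln_iff intro: less_le_trans[of _ "3/10"])
      finally have "1 + (\<Sum>i<k. ln (w i)) \<le> (\<Prod>i<k. w i)" .
      moreover have "real k \<le> (\<Sum>i<k. (2 - w i) ^ k + k * ln (w i))"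
        using sum_mono[of "{..<k}" "\<lambda>_. 1 :: real", OF G] by simp
      then have "1 \<le> (\<Sum>i<k. (2 - w i) ^ k) / k + (\<Sum>i<k. ln (w i))"
        using 4 by (simp add: sum.distrib field_simps flip: sum_distrib_left)
      ultimately show ?thesis
        unfolding eq by linarith
    qed
  qed
qed

subsection \<open>The upper bound\<close>

text \<open>If some \<open>x i\<close> is at most \<open>\<zeta> / k\<close>, its summand alone
  reaches \<open>1 - \<zeta>\<close> by Bernoulli's inequality; otherwise the product is large
  enough to make the left side negative. For \<open>j < k\<close> this replaces the sharp
  inequality.\<close>

lemma one_le_sum_power_plus_prod:
  fixes x :: "nat \<Rightarrow> real"
  assumes x: "\<And>i. i < j \<Longrightarrow> 0 \<le> x i \<and> x i \<le> 1" and "j \<le> k" and \<zeta>: "0 < \<zeta>" "\<zeta> \<le> 1"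
  shows "1 - \<zeta> - (k / \<zeta>) ^ k * (\<Prod>i<j. x i) \<le> (\<Sum>i<j. (1 - x i) ^ k)"
proof (cases "\<exists>i<j. x i \<le> \<zeta> / k")
  case True
  then obtain i where i: "i < j" "x i \<le> \<zeta> / k"
    by blast
  have "k * x i \<le> \<zeta>"
    using i \<open>j \<le> k\<close> by (simp add: field_simps)
  moreover have "1 + k * (- x i) \<le> (1 + (- x i)) ^ k"
    using x i by (intro Bernoulli_inequality) auto
  moreover have "(1 - x i) ^ k \<le> (\<Sum>i<j. (1 - x i) ^ k)"
    using x i by (intro member_le_sum) auto
  moreover have "0 \<le> (k / \<zeta>) ^ k * (\<Prod>i<j. x i)"
    using x \<zeta> by (intro mult_nonneg_nonneg prod_nonneg) auto
  ultimately show ?thesis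
    by simp
next
  case False
  have "1 \<le> (k / \<zeta>) ^ k * (\<Prod>i<j. x i)"
  proof (cases "k = 0")
    case False
    have "(\<zeta> / k) ^ k \<le> (\<zeta> / k) ^ j"
      using \<zeta> False \<open>j \<le> k\<close> by (intro power_decreasing) (auto simp: field_simps)
    also have "\<dots> = (\<Prod>i<j. \<zeta> / k)"
      by simp
    also have "\<dots> \<le> (\<Prod>i<j. x i)"
      using \<open>\<not> (\<exists>i<j. x i \<le> \<zeta> / k)\<close> \<zeta> by (intro prod_mono) (auto simp: not_le less_imp_le)
    finally have "(k / \<zeta>) ^ k * (\<zeta> / k) ^ k \<le> (k / \<zeta>) ^ k * (\<Prod>i<j. x i)"
      using \<zeta> by (intro mult_left_mono) auto
    then show ?thesis
      using \<zeta> False by (simp flip: power_mult_distrib)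
  qed (use \<open>j \<le> k\<close> in simp)
  moreover have "0 \<le> (\<Sum>i<j. (1 - x i) ^ k)"
    using x by (intro sum_nonneg) auto
  ultimately show ?thesis
    using \<zeta> by simp
qed

text \<open>Distinctness is imposed because \<chi> also has values on singletons; the counting
  lemmas require an irreflexive relation.\<close>

definition mono_edge :: "('a set \<Rightarrow> bool) \<Rightarrow> bool \<Rightarrow> 'a \<Rightarrow> 'a \<Rightarrow> bool" where
  "mono_edge \<chi> c u v \<longleftrightarrow> u \<noteq> v \<and> \<chi> {u, v} = c"

lemma mono_edge_sym: "mono_edge \<chi> c u v \<Longrightarrow> mono_edge \<chi> c v u"
  by (auto simp: mono_edge_def insert_commute)

lemma mono_edge_irrefl: "\<not> mono_edge \<chi> c u u"
  by (simp add: mono_edge_def)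

text \<open>The upper bound in contrapositive form. Choosing \<open>N\<^sub>0\<close> before
  \<open>V\<close>, \<chi> and \<open>n\<close> lets it become an additive constant later.\<close>

lemma few_pages_imp_bound:
  fixes \<epsilon> :: real
  assumes \<epsilon>: "0 < \<epsilon>" "\<epsilon> < 1" and "1 \<le> k"
  obtains N\<^sub>0 where "\<And>(V :: 'a set) \<chi> n. finite V \<Longrightarrow> N\<^sub>0 \<le> card V \<Longrightarrow>
      (\<And>c S. S \<subseteq> V \<Longrightarrow> card S = k \<Longrightarrow> (\<And>s t. s \<in> S \<Longrightarrow> t \<in> S \<Longrightarrow> s \<noteq> t \<Longrightarrow> mono_edge \<chi> c s t)
        \<Longrightarrow> card {u \<in> V. \<forall>s\<in>S. mono_edge \<chi> c s u} \<le> n)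
      \<Longrightarrow> (1 - \<epsilon>) * card V \<le> 2 ^ k * real n"
proof -
  define \<zeta> where "\<zeta> = \<epsilon> / 3"
  define K where "K = (k / \<zeta>) ^ k"
  \<comment> \<open>The entries of the minimum yield \<open>e1\<close>, for the case
    \<open>j = k\<close>, and \<open>e2\<close> and \<open>e3\<close>, for the case
    \<open>j < k\<close>.\<close>
  define e where "e = min 1 (min (\<epsilon> / (2 ^ k * (1 + k))) (min (\<epsilon> / (6 * K)) (\<epsilon> / (6 * k * (1 + 2 * k)))))"
  have \<zeta>: "0 < \<zeta>" "\<zeta> \<le> 1"
    using \<epsilon> by (auto simp: \<zeta>_def)
  have "K > 0"
    using \<zeta> \<open>1 \<le> k\<close> by (simp add: K_def)
  have "0 < real (2 ^ k * (1 + k))" "0 < real (6 * k * (1 + 2 * k))"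
    unfolding of_nat_0_less_iff using \<open>1 \<le> k\<close> by simp_all
  then have e: "0 < e" "e \<le> 1"
    unfolding e_def min_less_iff_conj using \<epsilon> \<open>K > 0\<close>
    by (intro conjI divide_pos_pos, simp_all)
  have e1: "2 ^ k * (1 + k) * e \<le> \<epsilon>"
  proof -
    have "e \<le> \<epsilon> / (2 ^ k * (1 + k))" by (simp add: e_def)
    then have "e * real (2 ^ k * (1 + k)) \<le> \<epsilon>"
      using \<open>0 < real (2 ^ k * (1 + k))\<close> by (subst (asm) pos_le_divide_eq)
    then show ?thesis
      by (simp add: mult.commute)
  qed
  have e2: "2 * K * e \<le> \<epsilon> / 3"
  proof -
    have "e \<le> \<epsilon> / (6 * K)" by (simp add: e_def)
    then show ?thesis
      using \<open>K > 0\<close> by (simp add: pos_le_divide_eq mult_ac)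
  qed
  have e3: "2 * k * (1 + 2 * k) * e \<le> \<epsilon> / 3"
  proof -
    have "e \<le> \<epsilon> / (6 * k * (1 + 2 * k))" by (simp add: e_def)
    then have "e * real (6 * k * (1 + 2 * k)) \<le> \<epsilon>"
      using \<open>0 < real (6 * k * (1 + 2 * k))\<close> by (subst (asm) pos_le_divide_eq)
    then show ?thesis
      by (simp add: algebra_simps)
  qed
  \<comment> \<open>A clique of this size makes the error in \<open>page_avg_clique_le\<close> at
    most \<open>e * card V\<close>.\<close>
  define M where "M = nat \<lceil>real k ^ 2 / e\<rceil> + 1"
  have M: "real k ^ 2 / M \<le> e" "0 < M"
  proof -
    show "0 < M"
      by (simp add: M_def)
    have "real k ^ 2 / e \<le> M"
      unfolding M_def by linarith
    then show "real k ^ 2 / M \<le> e"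
      using e \<open>0 < M\<close> by (simp add: pos_divide_le_eq mult.commute)
  qed
  obtain r where r: "\<And>(S :: 'a set) F. finite S \<Longrightarrow> r \<le> card S \<Longrightarrow>
      \<exists>Q\<subseteq>S. card Q = M \<and> clique Q F \<or> card Q = M \<and> indep Q F"
    using ramsey2[of M M] by blast
  obtain \<sigma> :: real where "\<sigma> > 0" and
    box: "\<And>(E :: 'a \<Rightarrow> 'a \<Rightarrow> bool) R. finite R \<Longrightarrow> R \<noteq> {} \<Longrightarrow> \<exists>j W. j \<le> k
      \<and> (\<forall>i<j. W i \<subseteq> R \<and> \<sigma> * card R \<le> card (W i)) \<and> 0 < clique_count E j W
      \<and> (\<forall>A. (\<forall>i<j. A i \<subseteq> W i) \<longrightarrow>
          ((\<Prod>i<j. card (A i) / card (W i)) - e) * clique_count E j W \<le> clique_count E j A)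
      \<and> (j < k \<longrightarrow> (\<Sum>u\<in>R. clique_count E j (\<lambda>i. W i \<inter> Collect (E u))) \<le> e * card R * clique_count E j W)"
    by (rule ex_maximal_regular_box[OF e, of k]) blast
  \<comment> \<open>Each side of the box will have at least \<open>\<sigma> * N / 2\<close>
    vertices, since \<open>R\<close> is at least half of \<open>V\<close>; so
    \<open>\<beta> * N\<close> is at most an \<open>e\<close>-fraction of it.\<close>
  define \<beta> where "\<beta> = e * \<sigma> / 2"
  have "\<beta> > 0"
    using e \<open>\<sigma> > 0\<close> by (simp add: \<beta>_def)
  define N\<^sub>0 where "N\<^sub>0 = nat \<lceil>max (r / \<beta>\<^sup>2) (1 / \<beta>)\<rceil> + 1"
  show ?thesis
  proof (rule that)
    fix V :: "'a set" and \<chi> n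
    assume V: "finite V" "N\<^sub>0 \<le> card V"
      and pages: "\<And>c S. S \<subseteq> V \<Longrightarrow> card S = k \<Longrightarrow>
        (\<And>s t. s \<in> S \<Longrightarrow> t \<in> S \<Longrightarrow> s \<noteq> t \<Longrightarrow> mono_edge \<chi> c s t)
        \<Longrightarrow> card {u \<in> V. \<forall>s\<in>S. mono_edge \<chi> c s u} \<le> n"
    define N where "N = card V"
    have N: "r / \<beta>\<^sup>2 \<le> N" "1 / \<beta> \<le> N" "0 < N"
      using V(2) unfolding N_def N\<^sub>0_def by linarith+
    have N': "r \<le> \<beta>\<^sup>2 * N" "1 \<le> \<beta> * N"
      using N(1,2) \<open>\<beta> > 0\<close> by (simp_all add: field_simps)
    define P where "P c W \<longleftrightarrow> page_avg (mono_edge \<chi> c) V k W \<le> n + e * N" for c W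
    obtain c R where R: "R \<subseteq> V" "N \<le> 2 * card R"
      and hered: "\<And>S. S \<subseteq> R \<Longrightarrow> \<exists>W\<subseteq>S. P c W \<and> card S - \<beta> * N \<le> card W"
      unfolding N_def
    proof (rule ex_hereditary_region[of V P r \<beta>])
      show "P c {}" for c
        using \<open>1 \<le> k\<close> e by (simp add: P_def page_avg_def power_0_left)
      show "P c (A \<union> B)" if "A \<subseteq> V" "B \<subseteq> V" "P c A" "P c B" "A \<inter> B = {}" for c A B
        using that V(1) unfolding P_def by (intro page_avg_Un_le) (auto intro: finite_subset)
      show "\<exists>c W. W \<subseteq> S \<and> W \<noteq> {} \<and> P c W" if "S \<subseteq> V" "r \<le> card S" for S
      proof -
        have "finite S"
          using that V(1) finite_subset by blast
        from r[OF this that(2), of "{f. \<chi> f}"]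
        obtain Q where Q: "Q \<subseteq> S" "card Q = M" "clique Q {f. \<chi> f} \<or> indep Q {f. \<chi> f}"
          by blast
        then obtain c where c: "\<And>u v. u \<in> Q \<Longrightarrow> v \<in> Q \<Longrightarrow> u \<noteq> v \<Longrightarrow> mono_edge \<chi> c u v"
          by (auto simp: clique_def indep_def mono_edge_def)
        have "Q \<subseteq> V" "Q \<noteq> {}"
          using Q M that by auto
        have "page_avg (mono_edge \<chi> c) V k Q \<le> n + N * (real k ^ 2 / card Q)"
          unfolding N_def
          by (rule page_avg_clique_le[OF mono_edge_sym mono_edge_irrefl V(1) _ \<open>Q \<subseteq> V\<close> \<open>Q \<noteq> {}\<close> c])
            (assumption | fact pages)+
        also have "\<dots> \<le> n + e * N"
          using M mult_left_mono[of "real k ^ 2 / M" e N] Q(2) by (simp add: mult.commute)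
        finally show ?thesis
          using Q \<open>Q \<noteq> {}\<close> unfolding P_def by blast
      qed
    qed (use V \<open>\<beta> > 0\<close> N' in \<open>auto simp: N_def\<close>)
    \<comment> \<open>The colour \<open>c\<close> attached to \<open>R\<close> is red from here on,
      and \<open>F\<close> is the blue graph.\<close>
    define F where "F = mono_edge \<chi> (\<not> c)"
    have finR: "finite R" "R \<noteq> {}"
      using R V N by (auto intro: finite_subset)
    obtain j W where "j \<le> k" and WR: "\<And>i. i < j \<Longrightarrow> W i \<subseteq> R" and Wlarge: "\<And>i. i < j \<Longrightarrow> \<sigma> * card R \<le> card (W i)"
      and Wpos: "0 < clique_count F j W"
      and low: "\<And>A. (\<And>i. i < j \<Longrightarrow> A i \<subseteq> W i) \<Longrightarrow>
          ((\<Prod>i<j. card (A i) / card (W i)) - e) * clique_count F j W \<le> clique_count F j A"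
      and few: "j < k \<Longrightarrow> (\<Sum>u\<in>R. clique_count F j (\<lambda>i. W i \<inter> Collect (F u))) \<le> e * card R * clique_count F j W"
      using box[OF finR, of F] by blast
    define x where "x i u = card (W i \<inter> Collect (F u)) / card (W i)" for i u
    have finW: "finite (W i)" if "i < j" for i
      using WR[OF that] finR finite_subset by blast
    have large: "\<beta> * N \<le> e * card (W i)" "1 \<le> e * card (W i)" if "i < j" for i
    proof -
      have "\<sigma> * N \<le> \<sigma> * (2 * card R)"
        using R(2) \<open>\<sigma> > 0\<close> by (intro mult_left_mono) linarith+
      then have "\<sigma> * N / 2 \<le> card (W i)"
        using Wlarge[OF that] by simp
      then have "e * (\<sigma> * N / 2) \<le> e * card (W i)"
        using e by (intro mult_left_mono) auto
      then show "\<beta> * N \<le> e * card (W i)"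
        by (simp add: \<beta>_def mult.assoc)
      with N'(2) show "1 \<le> e * card (W i)"
        by linarith
    qed
    have Wcard: "real (card (W i)) > 0" if "i < j" for i
      using large(2)[OF that] e by (cases "card (W i)") auto
    have x01: "0 \<le> x i u" "x i u \<le> 1" if "i < j" for i u
      using Wcard[OF that] finW[OF that] by (auto simp: x_def intro: card_mono)
    define b where "b = n + (1 + 2 * k) * e * N"
    have red: "(\<Sum>u\<in>V. (1 - x i u) ^ k) \<le> b" if i: "i < j" for i
    proof -
      \<comment> \<open>The page bound is known only for \<open>X\<close>, which is nearly all of
        \<open>W i\<close>. Passing to \<open>W i\<close> costs \<open>e\<close> for the vertices
        outside \<open>X\<close> and \<open>e\<close> for the vertex \<open>u\<close>
        itself.\<close>
      obtain X where X: "X \<subseteq> W i" "P c X" "card (W i) - \<beta> * N \<le> card X"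
        using hered[OF WR[OF i]] by blast
      have "finite X"
        using X finW[OF i] finite_subset by blast
      have "(1 - x i u) ^ k - k * (2 * e) \<le> (card (X \<inter> Collect (mono_edge \<chi> c u)) / card X) ^ k" for u
      proof (rule power_ge_power_minus)
        let ?Y = "X \<inter> Collect (mono_edge \<chi> c u)"
        have "W i \<subseteq> ?Y \<union> (W i - X) \<union> (W i \<inter> Collect (F u)) \<union> {u}"
          by (auto simp: F_def mono_edge_def)
        then have "card (W i) \<le> card (?Y \<union> (W i - X) \<union> (W i \<inter> Collect (F u)) \<union> {u})"
          using \<open>finite X\<close> finW[OF i] by (intro card_mono) auto
        also have "\<dots> \<le> card ?Y + card (W i - X) + card (W i \<inter> Collect (F u)) + 1"
          by (intro order_trans[OF card_Un_le] add_mono) auto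
        finally have "real (card (W i)) \<le> card ?Y + card (W i - X) + card (W i \<inter> Collect (F u)) + 1"
          by linarith
        moreover have "card (W i - X) \<le> \<beta> * N"
          using X finW[OF i] \<open>finite X\<close> card_mono[OF finW[OF i] X(1)]
          by (simp add: card_Diff_subset of_nat_diff)
        ultimately have *: "card (W i) - 2 * e * card (W i) - card (W i \<inter> Collect (F u)) \<le> card ?Y"
          using large[OF i] by linarith
        have "1 - x i u - 2 * e = (card (W i) - 2 * e * card (W i) - card (W i \<inter> Collect (F u))) / card (W i)"
          using Wcard[OF i] by (simp add: x_def field_simps)
        also have "\<dots> \<le> card ?Y / card (W i)"
          using * by (intro divide_right_mono) auto
        also have "\<dots> \<le> card ?Y / card X"
        proof (cases "X = {}")
          case False
          then show ?thesis
            using \<open>finite X\<close> card_mono[OF finW[OF i] X(1)] Wcard[OF i]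
            by (intro divide_left_mono) (auto simp: card_gt_0_iff)
        qed simp
        finally show "1 - x i u - 2 * e \<le> card ?Y / card X" .
      qed (use x01[OF i] e in auto)
      then have "(\<Sum>u\<in>V. (1 - x i u) ^ k - k * (2 * e)) \<le> page_avg (mono_edge \<chi> c) V k X"
        unfolding page_avg_def by (rule sum_mono)
      also have "\<dots> \<le> n + e * N"
        using X(2) by (simp add: P_def)
      finally show ?thesis
        by (simp add: sum_subtractf b_def N_def algebra_simps)
    qed
    have ext: "((\<Prod>i<j. x i u) - e) * clique_count F j W \<le> clique_count F j (\<lambda>i. W i \<inter> Collect (F u))" for u
      unfolding x_def by (rule low) auto
    \<comment> \<open>Division by the positive clique count turns bounds on extensions of blue
      cliques into bounds on products. It is applied to \<open>V\<close> if \<open>j = k\<close> and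
      to \<open>R\<close> if \<open>j < k\<close>.\<close>
    have sum_ext: "(\<Sum>u\<in>U. \<Prod>i<j. x i u) - card U * e \<le> t"
      if "(\<Sum>u\<in>U. clique_count F j (\<lambda>i. W i \<inter> Collect (F u))) \<le> t * clique_count F j W" for U t
    proof -
      have "((\<Sum>u\<in>U. \<Prod>i<j. x i u) - card U * e) * clique_count F j W
          = (\<Sum>u\<in>U. ((\<Prod>i<j. x i u) - e) * clique_count F j W)"
        by (simp add: sum_subtractf flip: sum_distrib_right)
      also have "\<dots> \<le> (\<Sum>u\<in>U. clique_count F j (\<lambda>i. W i \<inter> Collect (F u)))"
        by (rule sum_mono) (rule ext)
      also note that
      finally show ?thesis
        using Wpos by simp
    qed
    have "(1 - \<epsilon>) * N \<le> 2 ^ k * real n"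
    proof (cases "j = k")
      case True
      have "(\<Sum>u\<in>V. clique_count F k (\<lambda>i. W i \<inter> Collect (F u))) \<le> n * clique_count F k W"
        unfolding F_def by (rule sum_clique_count_le[OF mono_edge_sym mono_edge_irrefl V(1) pages])
          (use WR R True in blast)+
      then have blue: "(\<Sum>u\<in>V. \<Prod>i<k. x i u) \<le> n + e * N"
        using sum_ext[of V n] True by (simp add: N_def mult.commute)
      have "(\<Sum>u\<in>V. \<Sum>i<k. (1 - x i u) ^ k) = (\<Sum>i<k. \<Sum>u\<in>V. (1 - x i u) ^ k)"
        by (rule sum.swap)
      also have "\<dots> \<le> (\<Sum>i<k. b)"
        using red True by (intro sum_mono) auto
      finally have redsum: "(\<Sum>u\<in>V. (\<Sum>i<k. (1 - x i u) ^ k) / k) \<le> b"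
        using \<open>1 \<le> k\<close> by (simp add: field_simps flip: sum_divide_distrib)
      \<comment> \<open>The sharp inequality contributes 2 per vertex, matched by one
        \<open>n\<close> from blue and one \<open>n\<close> from red.\<close>
      have "2 * real N = (\<Sum>u\<in>V. 2)"
        by (simp add: N_def)
      also have "\<dots> \<le> (\<Sum>u\<in>V. 2 ^ k * ((\<Prod>i<k. x i u) + (\<Sum>i<k. (1 - x i u) ^ k) / k))"
        using x01 True \<open>1 \<le> k\<close> by (intro sum_mono prod_power_ineq) auto
      also have "\<dots> = 2 ^ k * ((\<Sum>u\<in>V. \<Prod>i<k. x i u) + (\<Sum>u\<in>V. (\<Sum>i<k. (1 - x i u) ^ k) / k))"
        by (simp add: sum.distrib flip: sum_distrib_left)
      also have "\<dots> \<le> 2 ^ k * ((n + e * N) + b)"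
        using blue redsum by (intro mult_left_mono) auto
      also have "\<dots> = 2 * (2 ^ k * n) + 2 * (2 ^ k * (1 + k) * e) * N"
        by (simp add: b_def algebra_simps)
      also have "\<dots> \<le> 2 * (2 ^ k * n) + 2 * \<epsilon> * N"
        using mult_right_mono[OF e1, of "2 * real N"] by (simp add: algebra_simps)
      finally show ?thesis
        by (simp add: algebra_simps)
    next
      case False
      with \<open>j \<le> k\<close> have "j < k"
        by simp
      \<comment> \<open>Maximality of \<open>j\<close> makes blue extensions rare only inside
        \<open>R\<close>, so the sums are restricted to \<open>R\<close>, at the price of the factor
        in \<open>N \<le> 2 * card R\<close>.\<close>
      have "(\<Sum>u\<in>R. \<Prod>i<j. x i u) \<le> 2 * e * card R"
        using sum_ext[OF few[OF \<open>j < k\<close>]] by (simp add: algebra_simps)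
      then have blue: "K * (\<Sum>u\<in>R. \<Prod>i<j. x i u) \<le> K * (2 * e * card R)"
        using \<open>K > 0\<close> by (intro mult_left_mono) auto
      have "(\<Sum>u\<in>R. \<Sum>i<j. (1 - x i u) ^ k) = (\<Sum>i<j. \<Sum>u\<in>R. (1 - x i u) ^ k)"
        by (rule sum.swap)
      also have "\<dots> \<le> (\<Sum>i<j. b)"
      proof (rule sum_mono)
        fix i assume "i \<in> {..<j}"
        then have "(\<Sum>u\<in>R. (1 - x i u) ^ k) \<le> (\<Sum>u\<in>V. (1 - x i u) ^ k)"
          using V R x01 by (intro sum_mono2) auto
        then show "(\<Sum>u\<in>R. (1 - x i u) ^ k) \<le> b"
          using red[of i] \<open>i \<in> {..<j}\<close> by simp
      qed
      finally have redsum: "(\<Sum>u\<in>R. \<Sum>i<j. (1 - x i u) ^ k) \<le> j * b"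
        by simp
      have "(1 - \<zeta> - 2 * K * e) * card R \<le> (1 - \<zeta>) * card R - K * (\<Sum>u\<in>R. \<Prod>i<j. x i u)"
        using blue by (simp add: algebra_simps)
      also have "\<dots> = (\<Sum>u\<in>R. 1 - \<zeta> - K * (\<Prod>i<j. x i u))"
        by (simp add: sum_subtractf sum.distrib sum_distrib_left algebra_simps)
      also have "\<dots> \<le> (\<Sum>u\<in>R. \<Sum>i<j. (1 - x i u) ^ k)"
        unfolding K_def using x01 \<zeta> \<open>j \<le> k\<close> by (intro sum_mono one_le_sum_power_plus_prod) auto
      also note redsum
      finally have main: "(1 - \<zeta> - 2 * K * e) * card R \<le> j * b" .
      have "0 \<le> 1 - \<zeta> - 2 * K * e"
        using e2 \<epsilon> by (simp add: \<zeta>_def)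
      then have "(1 - \<zeta> - 2 * K * e) * N \<le> (1 - \<zeta> - 2 * K * e) * (2 * card R)"
        using R(2) by (intro mult_left_mono) linarith+
      then have "(1 - \<zeta> - 2 * K * e) * N \<le> 2 * (j * b)"
        using main by linarith
      also have "\<dots> = 2 * j * real n + 2 * j * (1 + 2 * k) * e * N"
        by (simp add: b_def algebra_simps)
      also have "\<dots> \<le> 2 ^ k * real n + \<epsilon> / 3 * N"
      proof (rule add_mono)
        have "2 * j \<le> 2 ^ k"
        proof -
          have "Suc j \<le> 2 ^ j"
            by (induction j) auto
          then have "2 * j \<le> 2 ^ Suc j"
            by simp
          also have "(2::nat) ^ Suc j \<le> 2 ^ k"
            using \<open>j < k\<close> by (intro power_increasing) auto
          finally show ?thesis .
        qed
        then have "real (2 * j) \<le> real (2 ^ k)"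
          by (rule of_nat_mono)
        then show "2 * j * real n \<le> 2 ^ k * real n"
          by (intro mult_right_mono) auto
        have "2 * j * (1 + 2 * k) * e \<le> 2 * k * (1 + 2 * k) * e"
          using \<open>j \<le> k\<close> e by (intro mult_right_mono of_nat_mono mult_le_mono) auto
        then have "2 * j * (1 + 2 * k) * e \<le> \<epsilon> / 3"
          using e3 by (rule order_trans)
        then show "2 * j * (1 + 2 * k) * e * N \<le> \<epsilon> / 3 * N"
          by (rule mult_right_mono) simp
      qed
      finally have "(1 - \<zeta> - 2 * K * e - \<epsilon> / 3) * N \<le> 2 ^ k * real n"
        by (simp add: algebra_simps)
      moreover have "(1 - \<epsilon>) * N \<le> (1 - \<zeta> - 2 * K * e - \<epsilon> / 3) * N"
        using e2 by (intro mult_right_mono) (auto simp: \<zeta>_def)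
      ultimately show ?thesis
        by linarith
    qed
    then show "(1 - \<epsilon>) * card V \<le> 2 ^ k * real n"
      by (simp add: N_def)
  qed
qed

subsection \<open>Random colourings\<close>

lemma card_Pow_superset:
  assumes "finite U" "Q \<subseteq> U"
  shows "real (card {F \<in> Pow U. Q \<subseteq> F}) = 2 ^ card U / 2 ^ card Q"
proof -
  have "bij_betw (\<lambda>F. F \<union> Q) (Pow (U - Q)) {F \<in> Pow U. Q \<subseteq> F}"
    by (rule bij_betw_byWitness[where f' = "\<lambda>F. F - Q"]) (use assms in auto)
  then have "card {F \<in> Pow U. Q \<subseteq> F} = 2 ^ card (U - Q)"
    using bij_betw_same_card[of _ "Pow (U - Q)" "{F \<in> Pow U. Q \<subseteq> F}"] assms card_Pow[of "U - Q"] by simp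
  moreover have "card U = card (U - Q) + card Q"
    using assms by (simp add: card_Diff_subset card_mono finite_subset)
  ultimately show ?thesis
    by (simp add: power_add)
qed

text \<open>A binomial moment generating function. After expanding the product over
  \<open>T\<close>, disjointness gives the event that \<open>F\<close> contains every
  \<open>P v\<close> with \<open>v \<in> X\<close> probability
  \<open>1 / 2 ^ (k * card X)\<close>.\<close>

lemma sum_Pow_prod_superset:
  fixes \<mu> :: real
  assumes "finite U" "finite T" "\<And>v. v \<in> T \<Longrightarrow> P v \<subseteq> U \<and> card (P v) = k" "disjoint_family_on P T"
  shows "(\<Sum>F\<in>Pow U. \<Prod>v\<in>T. if P v \<subseteq> F then 1 + \<mu> else 1) = 2 ^ card U * (1 + \<mu> / 2 ^ k) ^ card T"
proof -
  have "(\<Prod>v\<in>T. if P v \<subseteq> F then 1 + \<mu> else 1) = (\<Sum>X\<in>Pow T. if (\<Union>v\<in>X. P v) \<subseteq> F then \<mu> ^ card X else 0)" for F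
  proof -
    have "(\<Prod>v\<in>T. if P v \<subseteq> F then 1 + \<mu> else 1) = (\<Prod>v\<in>T. (if P v \<subseteq> F then \<mu> else 0) + 1)"
      by (intro prod.cong) auto
    also have "\<dots> = (\<Sum>X\<in>Pow T. \<Prod>v\<in>X. if P v \<subseteq> F then \<mu> else 0)"
      by (subst prod_add[OF assms(2)]) simp
    also have "\<dots> = (\<Sum>X\<in>Pow T. if (\<Union>v\<in>X. P v) \<subseteq> F then \<mu> ^ card X else 0)"
    proof (rule sum.cong)
      fix X assume "X \<in> Pow T"
      then have "finite X"
        using assms(2) finite_subset by blast
      show "(\<Prod>v\<in>X. if P v \<subseteq> F then \<mu> else 0) = (if (\<Union>v\<in>X. P v) \<subseteq> F then \<mu> ^ card X else 0)"
      proof (cases "(\<Union>v\<in>X. P v) \<subseteq> F")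
        case True
        then have "(\<Prod>v\<in>X. if P v \<subseteq> F then \<mu> else 0) = (\<Prod>v\<in>X. \<mu>)"
          by (intro prod.cong) auto
        with True show ?thesis by simp
      next
        case False
        then obtain v where "v \<in> X" "\<not> P v \<subseteq> F"
          by blast
        then have "(\<Prod>v\<in>X. if P v \<subseteq> F then \<mu> else 0) = 0"
          using \<open>finite X\<close> by (intro prod_zero bexI[of _ v]) auto
        with False show ?thesis by simp
      qed
    qed simp
    finally show ?thesis .
  qed
  then have "(\<Sum>F\<in>Pow U. \<Prod>v\<in>T. if P v \<subseteq> F then 1 + \<mu> else 1)
      = (\<Sum>F\<in>Pow U. \<Sum>X\<in>Pow T. if (\<Union>v\<in>X. P v) \<subseteq> F then \<mu> ^ card X else 0)"
    by simp
  also have "\<dots> = (\<Sum>X\<in>Pow T. \<Sum>F\<in>Pow U. if (\<Union>v\<in>X. P v) \<subseteq> F then \<mu> ^ card X else 0)"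
    by (rule sum.swap)
  also have "\<dots> = (\<Sum>X\<in>Pow T. 2 ^ card U * (\<mu> / 2 ^ k) ^ card X)"
  proof (rule sum.cong)
    fix X assume X: "X \<in> Pow T"
    then have "finite X"
      using assms(2) finite_subset by blast
    have "card (\<Union>v\<in>X. P v) = (\<Sum>v\<in>X. card (P v))"
    proof (rule card_UN_disjoint[OF \<open>finite X\<close>])
      show "\<forall>v\<in>X. finite (P v)"
        using X assms(1,3) by (meson PowD finite_subset subsetD)
      show "\<forall>v\<in>X. \<forall>w\<in>X. v \<noteq> w \<longrightarrow> P v \<inter> P w = {}"
        using X assms(4) unfolding disjoint_family_on_def by blast
    qed
    also have "\<dots> = k * card X"
      using X assms(3) by (subst sum.cong[of X X _ "\<lambda>_. k"]) auto
    finally have "card (\<Union>v\<in>X. P v) = k * card X" .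
    moreover have "(\<Sum>F\<in>Pow U. if (\<Union>v\<in>X. P v) \<subseteq> F then \<mu> ^ card X else 0)
        = card {F \<in> Pow U. (\<Union>v\<in>X. P v) \<subseteq> F} * \<mu> ^ card X"
      using assms(1) by (simp add: sum.inter_filter[symmetric])
    moreover have "(\<Union>v\<in>X. P v) \<subseteq> U"
      using X assms(3) by blast
    ultimately show "(\<Sum>F\<in>Pow U. if (\<Union>v\<in>X. P v) \<subseteq> F then \<mu> ^ card X else 0)
        = 2 ^ card U * (\<mu> / 2 ^ k) ^ card X"
      using card_Pow_superset[OF assms(1), of "\<Union>v\<in>X. P v"] by (simp add: power_divide power_mult)
  qed simp
  also have "\<dots> = 2 ^ card U * (\<Sum>X\<in>Pow T. (\<Prod>v\<in>X. \<mu> / 2 ^ k) * (\<Prod>v\<in>T - X. 1))"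
    by (simp add: sum_distrib_left)
  also have "\<dots> = 2 ^ card U * (\<Prod>v\<in>T. \<mu> / 2 ^ k + 1)"
    by (subst prod_add[OF assms(2)]) simp
  finally show ?thesis
    by (simp add: add.commute)
qed

text \<open>Markov's inequality for \<open>(1 + \<mu>)\<^sup>X\<close>, where \<open>X\<close> counts the \<open>P v\<close> contained in a random set \<open>F\<close>.\<close>

lemma card_Pow_many_supersets:
  fixes \<mu> :: real
  assumes "finite U" "finite T" "\<And>v. v \<in> T \<Longrightarrow> P v \<subseteq> U \<and> card (P v) = k" "disjoint_family_on P T" "0 \<le> \<mu>"
  shows "card {F \<in> Pow U. n \<le> card {v \<in> T. P v \<subseteq> F}} * (1 + \<mu>) ^ n \<le> 2 ^ card U * (1 + \<mu> / 2 ^ k) ^ card T"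
proof -
  let ?B = "{F \<in> Pow U. n \<le> card {v \<in> T. P v \<subseteq> F}}"
  have p: "(\<Prod>v\<in>T. if P v \<subseteq> F then 1 + \<mu> else 1) = (1 + \<mu>) ^ card {v \<in> T. P v \<subseteq> F}" for F
    using assms(2) by (simp flip: prod.inter_filter)
  have "card ?B * (1 + \<mu>) ^ n = (\<Sum>F\<in>?B. (1 + \<mu>) ^ n)"
    by simp
  also have "\<dots> \<le> (\<Sum>F\<in>?B. \<Prod>v\<in>T. if P v \<subseteq> F then 1 + \<mu> else 1)"
    unfolding p using assms(5) by (intro sum_mono power_increasing) auto
  also have "\<dots> \<le> (\<Sum>F\<in>Pow U. \<Prod>v\<in>T. if P v \<subseteq> F then 1 + \<mu> else 1)"
    unfolding p using assms(1,5) by (intro sum_mono2) auto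
  also have "\<dots> = 2 ^ card U * (1 + \<mu> / 2 ^ k) ^ card T"
    by (rule sum_Pow_prod_superset[OF assms(1-4)])
  finally show ?thesis .
qed

text \<open>Union bound over at most \<open>N ^ k\<close> spines and two colours, where
  \<open>F\<close> is the set of edges coloured \<open>True\<close>.\<close>

lemma ex_colouring_without_book:
  fixes \<mu> :: real
  assumes "0 \<le> \<mu>" and few: "2 * real N ^ k * (1 + \<mu> / 2 ^ k) ^ N < (1 + \<mu>) ^ n"
  shows "\<exists>\<chi>. \<not> mono_copy (book k n) (complete_graph {..<N}) \<chi>"
proof -
  define U where "U = [{..<N}]\<^bsup>2\<^esup>"
  define P where "P S v = (\<lambda>s. {s, v}) ` S" for S :: "nat set" and v
  define X where "X S F = card {v \<in> {..<N} - S. P S v \<subseteq> F}" for S F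
  \<comment> \<open>Only edges between \<open>S\<close> and the pages are inspected. Ignoring the
    edges inside the spine can only enlarge the bad set.\<close>
  define B where "B S = {F \<in> Pow U. n \<le> X S F} \<union> {F \<in> Pow U. n \<le> X S (U - F)}" for S
  define \<S> where "\<S> = [{..<N}]\<^bsup>k\<^esup>"
  define b where "b = 2 ^ card U * (1 + \<mu> / 2 ^ k) ^ N"
  have finU: "finite U"
    by (simp add: U_def finite_imp_finite_nsets)
  have P: "P S v \<subseteq> U \<and> card (P S v) = k" if "S \<in> \<S>" "v \<in> {..<N} - S" for S v
  proof
    have "{s, v} \<in> U" if "s \<in> S" for s
      using \<open>S \<in> \<S>\<close> \<open>v \<in> {..<N} - S\<close> that by (auto simp: \<S>_def U_def nsets_def card_insert_if)
    then show "P S v \<subseteq> U"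
      by (auto simp: P_def)
    have "inj_on (\<lambda>s. {s, v}) S"
      using that by (auto simp: inj_on_def doubleton_eq_iff)
    then show "card (P S v) = k"
      using that by (simp add: P_def card_image \<S>_def nsets_def)
  qed
  have disj: "disjoint_family_on (P S) ({..<N} - S)" for S
    by (auto simp: disjoint_family_on_def P_def doubleton_eq_iff)
  have up: "card {F \<in> Pow U. n \<le> X S F} * (1 + \<mu>) ^ n \<le> b" if "S \<in> \<S>" for S
  proof -
    have "card {F \<in> Pow U. n \<le> X S F} * (1 + \<mu>) ^ n \<le> 2 ^ card U * (1 + \<mu> / 2 ^ k) ^ card ({..<N} - S)"
      unfolding X_def using P[OF that] disj finU \<open>0 \<le> \<mu>\<close> by (intro card_Pow_many_supersets) auto
    also have "\<dots> \<le> b"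
    proof -
      have "card ({..<N} - S) \<le> N"
        using card_mono[of "{..<N}" "{..<N} - S"] by simp
      then show ?thesis
        unfolding b_def using \<open>0 \<le> \<mu>\<close> by (intro mult_left_mono power_increasing) auto
    qed
    finally show ?thesis .
  qed
  have BS: "card (B S) * (1 + \<mu>) ^ n \<le> 2 * b" if "S \<in> \<S>" for S
  proof -
    have "bij_betw (\<lambda>F. U - F) {F \<in> Pow U. n \<le> X S (U - F)} {F \<in> Pow U. n \<le> X S F}"
      by (rule bij_betw_byWitness[where f' = "\<lambda>F. U - F"]) (auto simp: Diff_Diff_Int Int_absorb1)
    then have "card {F \<in> Pow U. n \<le> X S (U - F)} = card {F \<in> Pow U. n \<le> X S F}"
      by (rule bij_betw_same_card)
    then have "card (B S) \<le> 2 * card {F \<in> Pow U. n \<le> X S F}"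
      using card_Un_le[of "{F \<in> Pow U. n \<le> X S F}" "{F \<in> Pow U. n \<le> X S (U - F)}"] by (simp add: B_def)
    then have "card (B S) * (1 + \<mu>) ^ n \<le> real (2 * card {F \<in> Pow U. n \<le> X S F}) * (1 + \<mu>) ^ n"
      using \<open>0 \<le> \<mu>\<close> by (intro mult_right_mono of_nat_mono) auto
    then show ?thesis
      using up[OF that] by simp
  qed
  have "card \<S> \<le> N ^ k"
    using binomial_le_pow[of k N] by (cases "k \<le> N") (auto simp: \<S>_def binomial_eq_0)
  have "card (\<Union>S\<in>\<S>. B S) * (1 + \<mu>) ^ n \<le> (\<Sum>S\<in>\<S>. card (B S)) * (1 + \<mu>) ^ n"
    using \<open>0 \<le> \<mu>\<close>
    by (intro mult_right_mono of_nat_mono card_UN_le) (auto simp: \<S>_def finite_imp_finite_nsets)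
  also have "\<dots> = (\<Sum>S\<in>\<S>. card (B S) * (1 + \<mu>) ^ n)"
    by (simp add: sum_distrib_right)
  also have "\<dots> \<le> card \<S> * (2 * b)"
    using BS by (intro sum_bounded_above) auto
  also have "\<dots> \<le> real (N ^ k) * (2 * b)"
    by (rule mult_right_mono[OF of_nat_mono[OF \<open>card \<S> \<le> N ^ k\<close>]]) (use \<open>0 \<le> \<mu>\<close> in \<open>simp add: b_def\<close>)
  also have "\<dots> = 2 ^ card U * (2 * real N ^ k * (1 + \<mu> / 2 ^ k) ^ N)"
    by (simp add: b_def)
  also have "\<dots> < 2 ^ card U * (1 + \<mu>) ^ n"
    using few by simp
  finally have "card (\<Union>S\<in>\<S>. B S) < (2 :: real) ^ card U"
    using \<open>0 \<le> \<mu>\<close> by (simp add: zero_less_power add_pos_nonneg)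
  then have "(\<Union>S\<in>\<S>. B S) \<noteq> Pow U"
    using card_Pow[OF finU] by auto
  then obtain F where F: "F \<subseteq> U" "\<And>S. S \<in> \<S> \<Longrightarrow> F \<notin> B S"
    by (auto simp: B_def)
  have "\<not> mono_copy (book k n) (complete_graph {..<N}) (\<lambda>e. e \<in> F)"
  proof
    assume "mono_copy (book k n) (complete_graph {..<N}) (\<lambda>e. e \<in> F)"
    then obtain f c where f: "inj_on f {..<k + n}" "f ` {..<k + n} \<subseteq> {..<N}"
      and edges: "\<And>e. e \<in> snd (book k n) \<Longrightarrow> f ` e \<in> U \<and> (f ` e \<in> F) = c"
      unfolding mono_copy_def book_def complete_graph_def U_def by auto
    define S where "S = f ` {..<k}"
    have inj: "inj_on f {..<k}" "inj_on f {k..<k + n}"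
      using f(1) by (rule inj_on_subset; auto)+
    have "card S = k"
      unfolding S_def card_image[OF inj(1)] by simp
    then have "S \<in> \<S>"
      using f(2) by (auto simp: S_def \<S>_def nsets_def image_subset_iff)
    have inP: "P S (f v) \<subseteq> (if c then F else U - F) \<and> f v \<in> {..<N} - S" if "v \<in> {k..<k + n}" for v
    proof
      have "f ` {u, v} \<in> (if c then F else U - F)" if "u \<in> {..<k}" for u
        using edges[of "{u, v}"] that \<open>v \<in> {k..<k + n}\<close> by (auto simp: book_def)
      then show "P S (f v) \<subseteq> (if c then F else U - F)"
        by (auto simp: P_def S_def)
      have "f v \<notin> S"
        using f(1) that unfolding S_def inj_on_def by force
      then show "f v \<in> {..<N} - S"
        using f(2) that by auto
    qed
    have "n = card (f ` {k..<k + n})"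
      unfolding card_image[OF inj(2)] by simp
    also have "\<dots> \<le> X S (if c then F else U - F)"
    proof -
      have "f ` {k..<k + n} \<subseteq> {v \<in> {..<N} - S. P S v \<subseteq> (if c then F else U - F)}"
        by (rule image_subsetI) (use inP in blast)
      then show ?thesis
        unfolding X_def by (intro card_mono) auto
    qed
    finally have "F \<in> B S"
      using F(1) by (cases c) (simp_all add: B_def)
    then show False
      using F(2) \<open>S \<in> \<S>\<close> by blast
  qed
  then show ?thesis
    by blast
qed

lemma eventually_ex_colouring_without_book:
  fixes \<epsilon> :: real
  assumes \<epsilon>: "0 < \<epsilon>" "\<epsilon> < 1"
  shows "\<forall>\<^sub>F n in sequentially. \<exists>\<chi>. \<not> mono_copy (book k n) (complete_graph {..<nat \<lfloor>(1 - \<epsilon>) * 2 ^ k * real n\<rfloor>}) \<chi>"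
proof -
  define \<mu> where "\<mu> = \<epsilon> / 2"
  \<comment> \<open>Since \<open>\<mu> - \<mu>\<^sup>2 = \<mu> * (1 - \<epsilon>) + d\<close>, the
    rate \<open>d\<close> is what remains to beat the polynomial number of spines.\<close>
  define d where "d = \<epsilon>\<^sup>2 / 4"
  define C where "C = 2 * (2 ^ k / d) ^ k"
  have "d > 0"
    using \<epsilon> by (simp add: d_def)
  have ln: "\<mu> * (1 - \<epsilon>) + d \<le> ln (1 + \<mu>)"
    using ln_one_plus_pos_lower_bound[of \<mu>] \<epsilon> by (simp add: \<mu>_def d_def power2_eq_square field_simps)
  have "filterlim (\<lambda>n. d * real n) at_top sequentially"
    using \<open>d > 0\<close> by (intro filterlim_tendsto_pos_mult_at_top[OF tendsto_const] filterlim_real_sequentially)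
  then have "(\<lambda>n. C * ((d * real n) ^ k / exp (d * real n))) \<longlonglongrightarrow> C * 0"
    by (intro tendsto_mult_left filterlim_compose[OF tendsto_power_div_exp_0])
  then have "\<forall>\<^sub>F n in sequentially. C * ((d * real n) ^ k / exp (d * real n)) < 1"
    by (rule order_tendstoD) simp
  then show ?thesis
  proof eventually_elim
    case (elim n)
    define N where "N = nat \<lfloor>(1 - \<epsilon>) * 2 ^ k * real n\<rfloor>"
    have N: "real N \<le> (1 - \<epsilon>) * 2 ^ k * real n"
      using \<epsilon> by (simp add: N_def)
    also have "\<dots> \<le> 2 ^ k * real n"
      using \<epsilon> by (intro mult_right_mono) auto
    finally have N2: "real N \<le> 2 ^ k * real n" .
    have "(1 + \<mu> / 2 ^ k) ^ N \<le> exp (\<mu> / 2 ^ k) ^ N"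
      using \<epsilon> by (intro power_mono exp_ge_add_one_self) (auto simp: \<mu>_def)
    also have "\<dots> = exp (\<mu> / 2 ^ k * N)"
      by (rule exp_of_nat2_mult[symmetric])
    also have "\<dots> \<le> exp (\<mu> / 2 ^ k * ((1 - \<epsilon>) * 2 ^ k * real n))"
      unfolding exp_le_cancel_iff using N \<epsilon> by (intro mult_left_mono) (auto simp: \<mu>_def)
    also have "\<dots> = exp (\<mu> * (1 - \<epsilon>) * n)"
      by simp
    finally have 1: "(1 + \<mu> / 2 ^ k) ^ N \<le> exp (\<mu> * (1 - \<epsilon>) * n)" .
    have "2 * real N ^ k * (1 + \<mu> / 2 ^ k) ^ N \<le> 2 * (2 ^ k * n) ^ k * exp (\<mu> * (1 - \<epsilon>) * n)"
      using 1 power_mono[OF N2, of k] \<epsilon> by (intro mult_mono) (auto simp: \<mu>_def)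
    also have "\<dots> = C * (d * real n) ^ k * exp (\<mu> * (1 - \<epsilon>) * n)"
      using \<open>d > 0\<close> by (simp add: C_def flip: power_mult_distrib)
    also have "\<dots> < exp (d * n) * exp (\<mu> * (1 - \<epsilon>) * n)"
      using elim by (intro mult_strict_right_mono) (auto simp: field_simps)
    also have "\<dots> = exp ((\<mu> * (1 - \<epsilon>) + d) * n)"
      by (simp add: algebra_simps flip: exp_add)
    also have "\<dots> \<le> exp (ln (1 + \<mu>) * n)"
      unfolding exp_le_cancel_iff by (intro mult_right_mono ln) auto
    also have "\<dots> = (1 + \<mu>) ^ n"
      using \<epsilon> by (subst exp_of_nat2_mult) (simp add: \<mu>_def)
    finally have "2 * real N ^ k * (1 + \<mu> / 2 ^ k) ^ N < (1 + \<mu>) ^ n" .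
    then show ?case
      unfolding N_def[symmetric] using \<epsilon> by (intro ex_colouring_without_book[of \<mu>]) (auto simp: \<mu>_def)
  qed
qed

subsection \<open>The Ramsey number of books\<close>

text \<open>One bad colouring thereby excludes every Ramsey number up to its number of
  vertices.\<close>

lemma mono_copy_complete_graph_mono:
  assumes "V \<subseteq> W" "mono_copy H (complete_graph V) \<chi>"
  shows "mono_copy H (complete_graph W) \<chi>"
proof -
  obtain f c where f: "inj_on f (fst H)" "f ` fst H \<subseteq> V" "\<forall>e\<in>snd H. f ` e \<in> [V]\<^bsup>2\<^esup> \<and> \<chi> (f ` e) = c"
    using assms(2) unfolding mono_copy_def complete_graph_def by auto
  have "f ` fst H \<subseteq> W" "\<forall>e\<in>snd H. f ` e \<in> [W]\<^bsup>2\<^esup> \<and> \<chi> (f ` e) = c"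
    using f(2,3) assms(1) nsets_mono[OF assms(1), of 2] by blast+
  then show ?thesis
    unfolding mono_copy_def complete_graph_def fst_conv snd_conv using f(1) by blast
qed

text \<open>A bijection onto the spine and one onto \<open>n\<close> chosen pages are glued; the
  pages avoid \<open>S\<close> because \<open>mono_edge\<close> is irreflexive.\<close>

lemma mono_copy_bookI:
  assumes "finite V" "S \<subseteq> V" "card S = k" and clique: "\<And>s t. s \<in> S \<Longrightarrow> t \<in> S \<Longrightarrow> s \<noteq> t \<Longrightarrow> mono_edge \<chi> c s t"
    and pages: "n \<le> card {u \<in> V. \<forall>s\<in>S. mono_edge \<chi> c s u}"
  shows "mono_copy (book k n) (complete_graph V) \<chi>"
proof -
  obtain T where T: "T \<subseteq> {u \<in> V. \<forall>s\<in>S. mono_edge \<chi> c s u}" "card T = n" "finite T"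
    using obtain_subset_with_card_n[OF pages] by blast
  have "S \<inter> T = {}"
    using T(1) mono_edge_irrefl[of \<chi> c] by blast
  have "finite S"
    using assms finite_subset by blast
  obtain g where g: "bij_betw g {..<k} S"
    using finite_same_card_bij[of "{..<k}" S] \<open>finite S\<close> assms(3) by auto
  obtain h where h: "bij_betw h {k..<k + n} T"
    using finite_same_card_bij[of "{k..<k + n}" T] T by auto
  define f where "f i = (if i < k then g i else h i)" for i
  have "bij_betw f {..<k} S \<longleftrightarrow> bij_betw g {..<k} S"
    by (rule bij_betw_cong) (simp add: f_def)
  moreover have "bij_betw f {k..<k + n} T \<longleftrightarrow> bij_betw h {k..<k + n} T"
    by (rule bij_betw_cong) (simp add: f_def)
  ultimately have "bij_betw f {..<k} S" "bij_betw f {k..<k + n} T"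
    using g h by blast+
  then have "bij_betw f ({..<k} \<union> {k..<k + n}) (S \<union> T)"
    by (rule bij_betw_combine) fact
  moreover have "{..<k} \<union> {k..<k + n} = {..<k + n}"
    by auto
  ultimately have f: "inj_on f {..<k + n}" "f ` {..<k + n} = S \<union> T"
    by (auto simp: bij_betw_def)
  have fS: "f i \<in> S" if "i < k" for i
    using that \<open>bij_betw f {..<k} S\<close> by (auto dest: bij_betwE)
  have fT: "f i \<in> T" if "k \<le> i" "i < k + n" for i
    using that \<open>bij_betw f {k..<k + n} T\<close> by (auto dest: bij_betwE)
  have edge: "{s, t} \<in> [V]\<^bsup>2\<^esup> \<and> \<chi> {s, t} = c" if "s \<in> V" "t \<in> V" "mono_edge \<chi> c s t" for s t
    using that by (auto simp: mono_edge_def nsets_def)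
  have "f ` e \<in> [V]\<^bsup>2\<^esup> \<and> \<chi> (f ` e) = c" if "e \<in> snd (book k n)" for e
  proof -
    have "e \<in> [{..<k}]\<^bsup>2\<^esup> \<or> (\<exists>u v. e = {u, v} \<and> u < k \<and> k \<le> v \<and> v < k + n)"
      using that by (auto simp: book_def)
    then obtain u v where e: "e = {u, v}" "u < k" "v < k + n" "u \<noteq> v"
    proof
      assume "e \<in> [{..<k}]\<^bsup>2\<^esup>"
      then obtain u v where "e = {u, v}" "u \<noteq> v"
        by (auto simp: nsets_def card_2_iff)
      moreover from this have "u < k" "v < k"
        using \<open>e \<in> [{..<k}]\<^bsup>2\<^esup>\<close> by (auto simp: nsets_def)
      ultimately show ?thesis
        by (intro that[of u v]) auto
    next
      assume "\<exists>u v. e = {u, v} \<and> u < k \<and> k \<le> v \<and> v < k + n"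
      then show ?thesis
        using that by fastforce
    qed
    have "f u \<noteq> f v"
      using e f(1) by (auto simp: inj_on_def)
    then have "mono_edge \<chi> c (f u) (f v)"
      using e fS[of u] fS[of v] fT[of v] clique T(1) by (cases "v < k") auto
    moreover have "f u \<in> V" "f v \<in> V"
      using e f(2) T(1) assms(2) by auto
    ultimately show ?thesis
      using edge[of "f u" "f v"] e by simp
  qed
  moreover have "f ` {..<k + n} \<subseteq> V"
    using f(2) T(1) assms(2) by auto
  ultimately show ?thesis
    using f(1) unfolding mono_copy_def complete_graph_def by (intro exI[of _ f] exI[of _ c]) (simp add: book_def)
qed

lemma mono_copy_ramsey_number_book:
  "mono_copy (book k n) (complete_graph {..<ramsey_number (book k n)}) \<chi>"
proof -
  have "finite (fst (book k n))"
    by (simp add: book_def)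
  then have "\<exists>N::nat. \<forall>\<chi>. mono_copy (fst (book k n), snd (book k n)) (complete_graph {..<N}) \<chi>"
    using book_simple_graph by (rule ramsey_number_exists)
  then have "\<exists>N::nat. \<forall>\<chi>. mono_copy (book k n) (complete_graph {..<N}) \<chi>"
    by simp
  then show ?thesis
    unfolding ramsey_number_def by (rule LeastI2_ex) blast
qed

lemma ramsey_number_book_lower:
  assumes "0 < \<epsilon>" "\<epsilon> < 1"
  shows "\<forall>\<^sub>F n in sequentially. (1 - \<epsilon>) * 2 ^ k * real n \<le> ramsey_number (book k n)"
  using eventually_ex_colouring_without_book[OF assms, of k]
proof eventually_elim
  case (elim n)
  define N where "N = nat \<lfloor>(1 - \<epsilon>) * 2 ^ k * real n\<rfloor>"
  have "\<not> ramsey_number (book k n) \<le> N"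
    using elim mono_copy_complete_graph_mono[OF _ mono_copy_ramsey_number_book] unfolding N_def
    by (meson lessThan_subset_iff)
  then show ?case
    unfolding N_def by linarith
qed

lemma ramsey_number_book_upper:
  assumes "0 < \<epsilon>" "\<epsilon> < 1"
  obtains C :: real where "\<And>n. ramsey_number (book k n) \<le> 2 ^ k * real n / (1 - \<epsilon>) + C"
proof (cases "k = 0")
  case True
  have "real (ramsey_number (book k n)) \<le> 2 ^ k * real n / (1 - \<epsilon>) + 0" for n
  proof -
    \<comment> \<open>With an empty spine the book has no edges, so \<open>n\<close> vertices
      suffice; \<open>few_pages_imp_bound\<close> covers only \<open>1 \<le> k\<close>.\<close>
    have "mono_copy (book 0 n) (complete_graph {..<n}) \<chi>" for \<chi>
      by (rule mono_copy_bookI[where S = "{}"]) auto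
    then have "ramsey_number (book 0 n) \<le> n"
      unfolding ramsey_number_def by (intro Least_le) blast
    moreover have "real n \<le> real n / (1 - \<epsilon>)"
      using assms by (simp add: field_simps)
    ultimately show ?thesis
      using True by simp
  qed
  then show ?thesis
    by (rule that)
next
  case False
  then have "1 \<le> k"
    by simp
  show ?thesis
  proof (rule few_pages_imp_bound[where 'a = nat, OF assms \<open>1 \<le> k\<close>])
    fix N\<^sub>0
    assume N\<^sub>0: "\<And>(V :: nat set) \<chi> n. finite V \<Longrightarrow> N\<^sub>0 \<le> card V \<Longrightarrow>
      (\<And>c S. S \<subseteq> V \<Longrightarrow> card S = k \<Longrightarrow> (\<And>s t. s \<in> S \<Longrightarrow> t \<in> S \<Longrightarrow> s \<noteq> t \<Longrightarrow> mono_edge \<chi> c s t)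
        \<Longrightarrow> card {u \<in> V. \<forall>s\<in>S. mono_edge \<chi> c s u} \<le> n)
      \<Longrightarrow> (1 - \<epsilon>) * card V \<le> 2 ^ k * real n"
    have "real (ramsey_number (book k n)) \<le> 2 ^ k * real n / (1 - \<epsilon>) + (N\<^sub>0 + 1)" for n
    proof -
      \<comment> \<open>The summand \<open>N\<^sub>0\<close> meets the size condition, and the final
        1 makes \<open>N\<close> strictly exceed the quotient, against the page bound.\<close>
      define N where "N = N\<^sub>0 + nat \<lfloor>2 ^ k * real n / (1 - \<epsilon>)\<rfloor> + 1"
      have "0 \<le> 2 ^ k * real n / (1 - \<epsilon>)"
        using assms by simp
      then have N: "2 ^ k * real n / (1 - \<epsilon>) < N" "N \<le> 2 ^ k * real n / (1 - \<epsilon>) + (N\<^sub>0 + 1)"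
        unfolding N_def by linarith+
      have "mono_copy (book k n) (complete_graph {..<N}) \<chi>" for \<chi>
      proof (rule ccontr)
        assume no: "\<not> ?thesis"
        have "(1 - \<epsilon>) * card {..<N} \<le> 2 ^ k * real n"
        proof (rule N\<^sub>0)
          show "N\<^sub>0 \<le> card {..<N}"
            by (simp add: N_def)
          show "card {u \<in> {..<N}. \<forall>s\<in>S. mono_edge \<chi> c s u} \<le> n"
            if "S \<subseteq> {..<N}" "card S = k" "\<And>s t. s \<in> S \<Longrightarrow> t \<in> S \<Longrightarrow> s \<noteq> t \<Longrightarrow> mono_edge \<chi> c s t" for c S
            using mono_copy_bookI[OF finite_lessThan that, of n] no by (meson nat_le_linear)
        qed simp
        then show False
          using N(1) assms by (simp add: field_simps)
      qed
      then have "ramsey_number (book k n) \<le> N"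
        unfolding ramsey_number_def by (intro Least_le) blast
      then show ?thesis
        using N(2) by linarith
    qed
    then show ?thesis
      by (rule that)
  qed
qed

theorem theorem1:
  fixes k :: nat
  shows "(\<lambda>n. real (ramsey_number (book k n)) - 2 ^ k * real n) \<in> o(\<lambda>n. real n)
    \<and> (\<lambda>n. real (ramsey_number (book k n)) / real n) \<longlonglongrightarrow> 2 ^ k"
proof -
  let ?r = "\<lambda>n. real (ramsey_number (book k n))"
  have pos: "\<forall>\<^sub>F n in sequentially. 0 < real n"
    using eventually_gt_at_top[of 0] by eventually_elim simp
  have lim: "(\<lambda>n. ?r n / real n) \<longlonglongrightarrow> 2 ^ k"
  proof (rule order_tendstoI)
    fix a :: real assume a: "a < 2 ^ k"
    \<comment> \<open>The second entry uses up half of the gap between \<open>a\<close> and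
      \<open>2 ^ k\<close>; the first keeps \<open>\<epsilon> < 1\<close> when \<open>a\<close> is
      far below 0.\<close>
    define \<epsilon> where "\<epsilon> = min (1 / 2) ((2 ^ k - a) / 2 ^ Suc k)"
    have \<epsilon>: "0 < \<epsilon>" "\<epsilon> < 1"
      using a by (auto simp: \<epsilon>_def)
    have "\<epsilon> * 2 ^ k \<le> (2 ^ k - a) / 2 ^ Suc k * 2 ^ k"
      unfolding \<epsilon>_def by (intro mult_right_mono) auto
    also have "\<dots> = (2 ^ k - a) / 2"
      by simp
    finally have "a < (1 - \<epsilon>) * 2 ^ k"
      using a by (simp add: algebra_simps)
    show "\<forall>\<^sub>F n in sequentially. a < ?r n / real n"
      using ramsey_number_book_lower[OF \<epsilon>, of k] pos
    proof eventually_elim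
      case (elim n)
      then have "(1 - \<epsilon>) * 2 ^ k \<le> ?r n / real n"
        by (simp add: field_simps)
      with \<open>a < (1 - \<epsilon>) * 2 ^ k\<close> show ?case
        by linarith
    qed
  next
    fix a :: real assume a: "2 ^ k < a"
    have "0 < a"
      using a by (meson less_trans zero_less_numeral zero_less_power)
    \<comment> \<open>Half of the relative gap stays in reserve to absorb
      \<open>C / real n\<close>.\<close>
    define \<epsilon> where "\<epsilon> = (1 - 2 ^ k / a) / 2"
    have \<epsilon>: "0 < \<epsilon>" "\<epsilon> < 1"
      using a \<open>0 < a\<close> by (auto simp: \<epsilon>_def field_simps intro: add_pos_pos)
    have "2 ^ k / a < 1 - \<epsilon>"
      using a \<open>0 < a\<close> by (simp add: \<epsilon>_def field_simps)
    then have lt: "2 ^ k / (1 - \<epsilon>) < a"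
      using \<epsilon> \<open>0 < a\<close> by (simp add: field_simps)
    obtain C where C: "\<And>n. ?r n \<le> 2 ^ k * real n / (1 - \<epsilon>) + C"
      using ramsey_number_book_upper[OF \<epsilon>, of k] by blast
    have "(\<lambda>n. 2 ^ k / (1 - \<epsilon>) + C / real n) \<longlonglongrightarrow> 2 ^ k / (1 - \<epsilon>) + 0"
      by (intro tendsto_add tendsto_const lim_const_over_n)
    then have "\<forall>\<^sub>F n in sequentially. 2 ^ k / (1 - \<epsilon>) + C / real n < a"
      using lt by (intro order_tendstoD) auto
    then show "\<forall>\<^sub>F n in sequentially. ?r n / real n < a"
      using pos
    proof eventually_elim
      case (elim n)
      have "?r n / real n \<le> (2 ^ k * real n / (1 - \<epsilon>) + C) / real n"
        using C[of n] elim by (intro divide_right_mono) auto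
      also have "\<dots> = 2 ^ k / (1 - \<epsilon>) + C / real n"
        using elim by (simp add: add_divide_distrib)
      finally show ?case
        using elim by linarith
    qed
  qed
  have "\<forall>\<^sub>F n in sequentially. ?r n / real n - 2 ^ k = (?r n - 2 ^ k * real n) / real n"
    using pos by eventually_elim (simp add: diff_divide_distrib)
  then have "(\<lambda>n. (?r n - 2 ^ k * real n) / real n) \<longlonglongrightarrow> 2 ^ k - 2 ^ k"
    by (rule Lim_transform_eventually[OF tendsto_diff[OF lim tendsto_const]])
  then have "(\<lambda>n. (?r n - 2 ^ k * real n) / real n) \<longlonglongrightarrow> 0"
    by simp
  then have "(\<lambda>n. ?r n - 2 ^ k * real n) \<in> o(\<lambda>n. real n)"
    using pos by (intro smalloI_tendsto) (auto elim: eventually_mono)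
  with lim show ?thesis
    by blast
qed

end
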